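(* Let $f(X) \in \mathbb{Z}[X]$ be a fixed squarefree polynomial. For a prime $p$ let $T_f(p)$ denote the number of integers $x$ with $1 \le x \le p-1$ satisfying $$x^{f(x)} \equiv 1 \pmod p .$$ Then $$T_f(p) \le p^{6/13 + o(1)}$$ as $p \to \infty$ over the primes.
   Context: Squarefree means squarefree as a polynomial (not divisible by the square of a nonconstant polynomial; in particular $f \ne 0$). If $f(x)$ is negative, $x^{f(x)}$ is interpreted as a power of the inverse of $x$ modulo $p$. The polynomial $f$ is fixed as $p\to\infty$, so the $o(1)$ term may depend on $f$. *)

theory Defs
  imports
    "HOL-Computational_Algebra.Computational_Algebra"
    "HOL-Number_Theory.Number_Theory"
    "HOL-Library.Landau_Symbols"
begin

text \<open>
  The library's \<^const>\<open>squarefree\<close> on \<^typ>\<open>int poly\<close> also forbids square constant divisors (it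
  rejects the constant polynomial 4, for instance). The notion here only concerns nonconstant
  divisors; it does exclude the zero polynomial, see \<open>squarefree_poly_nonzero\<close>.
\<close>

definition squarefree_poly :: "int poly \<Rightarrow> bool" where
  "squarefree_poly f \<longleftrightarrow> (\<forall>g :: int poly. degree g > 0 \<longrightarrow> \<not> g ^ 2 dvd f)"

lemma squarefree_poly_nonzero: "squarefree_poly f \<Longrightarrow> f \<noteq> 0"
  unfolding squarefree_poly_def by (auto dest: spec[of _ "[:0, 1:]"])

definition mod_powi :: "nat \<Rightarrow> int \<Rightarrow> int \<Rightarrow> int" where
  "mod_powi p x k =
     (if k \<ge> 0 then x ^ nat k else modular_inverse (int p) x ^ nat (- k))"

definition T :: "int poly \<Rightarrow> nat \<Rightarrow> nat" where
  "T f p = card {x :: int. 1 \<le> x \<and> x \<le> int p - 1 \<and> [mod_powi p x (poly f x) = 1] (mod int p)}"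

text \<open>The filter for \<open>p \<longrightarrow> \<infinity>\<close> with \<open>p\<close> restricted to the primes.\<close>

definition primes_at_top :: "nat filter" where
  "primes_at_top = inf at_top (principal {p. prime p})"

lemma eventually_primes_at_top:
  "eventually P primes_at_top \<longleftrightarrow> (\<exists>N. \<forall>p\<ge>N. prime p \<longrightarrow> P p)"
  by (simp add: primes_at_top_def eventually_inf_principal eventually_at_top_linorder)

end

theory Submission
  imports Defs
begin

text \<open>
  Let \<open>x\<close> be a solution and \<open>d = gcd (f x) (p - 1)\<close>. The order of \<open>x\<close> modulo \<open>p\<close> divides both
  \<open>f x\<close> and \<open>p - 1\<close>, so \<open>x\<close> lies in the subgroup \<open>G\<close> of order \<open>d\<close> of the units modulo \<open>p\<close>, and
  \<open>d\<close> divides \<open>f x\<close>. Since \<open>f\<close> is squarefree it has at most \<open>p powr o(1)\<close> roots modulo \<open>d\<close>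
  (\<open>card_roots_mod_growth\<close>), and \<open>p - 1\<close> has at most \<open>p powr o(1)\<close> divisors
  (\<open>card_divisors_growth\<close>). It therefore suffices to show, for each \<open>d\<close> and each residue class
  modulo \<open>d\<close>, that the set \<open>A\<close> of elements of \<open>G\<close> in this class and in \<open>[1, p - 1]\<close> has
  \<open>O(p powr (6/13))\<close> elements (\<open>card_class_le\<close>).

  Trivially \<open>card A\<close> is at most \<open>d\<close>, and at most about \<open>p / d\<close>. This leaves the range of \<open>d\<close>
  between \<open>p powr (6/13)\<close> and \<open>p powr (7/13)\<close>. There the additive structure of \<open>A\<close> is played
  against the multiplicative structure of \<open>G\<close>: the differences of elements of \<open>A\<close> are multiples of
  \<open>d\<close> of size less than \<open>p\<close>, so they take only about \<open>2 p / d\<close> values, while a fixed nonzero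
  difference \<open>h\<close> occurs at most as often as there are \<open>x\<close> with both \<open>x\<close> and \<open>x + h\<close> in \<open>G\<close>.
  Stepanov's method bounds the latter number by \<open>2 d / b\<close> for every \<open>b \<ge> 1\<close> with \<open>8 b\<^sup>3 \<le> d\<close> and
  \<open>2 b d \<le> p\<close> (\<open>shifted_subgroup_intersection\<close>). Counting pairs gives
  \<open>(card A)\<^sup>2 \<le> card A + 4 p / b\<close>, and \<open>b\<close> close to \<open>p powr (1/13)\<close> yields the exponent
  \<open>6/13 = (1 - 1/13) / 2\<close>.

  In Stepanov's method one looks for a polynomial \<open>\<Psi>\<close>, not zero modulo \<open>p\<close>, of small degree that
  vanishes to high order at every \<open>x\<close> with \<open>x ^ t = (x + h) ^ t = 1\<close>. It has the form
  \<open>\<Sum> u X ^ a X ^ (t c) (X + h) ^ (t j)\<close> with small \<open>a\<close>, \<open>c\<close>, \<open>j\<close>. The derivation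
  \<open>X (X + h) d/dX\<close> multiplies \<open>X ^ (t c) (X + h) ^ (t j)\<close> by a linear polynomial, and at the points
  in question this product is \<open>1\<close>. So the derivatives up to a given order vanish there as soon as certain
  polynomials of low degree vanish identically, which is a small system of linear equations for
  the coefficients \<open>u\<close>, solvable by the pigeonhole principle. That \<open>\<Psi>\<close> does not vanish
  identically follows from the fact that a polynomial with \<open>m\<close> terms of degree less than \<open>p\<close>
  cannot vanish to order \<open>m\<close> at a nonzero point (\<open>sparse_poly_vanishing_mod\<close>).
\<close>

hide_const (open) up_ring.coeff Module.smult UnivPoly.monom

section \<open>Zeros of integer polynomials modulo a prime\<close>

lemma const_prime_dvd_mult:
  assumes "prime (p :: int)" "[:p:] dvd f * g"
  shows "[:p:] dvd f \<or> [:p:] dvd g"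
proof -
  have "prime_elem [:p:]"
    using assms(1) by (subst prime_elem_const_poly_iff) (rule prime_imp_prime_elem)
  then show ?thesis
    using assms(2) by (simp add: prime_elem_dvd_mult_iff)
qed

lemma const_not_dvd_linear_power:
  assumes "prime (p :: int)"
  shows "\<not> [:p:] dvd [:- x, 1:] ^ n"
proof
  assume "[:p:] dvd [:- x, 1:] ^ n"
  moreover have "prime_elem [:p:]"
    using assms(1) by (subst prime_elem_const_poly_iff) (rule prime_imp_prime_elem)
  ultimately have "[:p:] dvd [:- x, 1:]"
    using prime_elem_dvd_power by blast
  then have "p dvd coeff [:- x, 1:] 1"
    by (simp only: const_poly_dvd_iff)
  with assms show False
    by (simp add: not_prime_unit)
qed

lemma const_dvd_imp_dvd_poly: "[:p:] dvd f \<Longrightarrow> p dvd poly f x" for p :: int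
  by (auto elim!: dvdE)

lemma split_off_root:
  fixes f :: "'a :: comm_ring_1 poly"
  obtains g where "f = [:- x, 1:] * g + [:poly f x:]"
proof -
  have "[:- x, 1:] dvd f - [:poly f x:]"
    by (simp flip: poly_eq_0_iff_dvd)
  then obtain g where "f - [:poly f x:] = [:- x, 1:] * g" ..
  then have "f = [:- x, 1:] * g + [:poly f x:]"
    by (metis diff_add_cancel)
  then show thesis by (rule that)
qed

text \<open>
  Divisibility of \<open>f\<close> by \<open>(X - x) ^ n\<close> over the field with \<open>p\<close> elements. The prime \<open>p\<close> is a
  variable, so this field is not the universe of a fixed type; polynomials over it are
  represented by integer polynomials up to multiples of the constant polynomial \<open>[:p:]\<close>, which
  is a prime element.
\<close>

definition vanishes_mod :: "int \<Rightarrow> nat \<Rightarrow> int \<Rightarrow> int poly \<Rightarrow> bool" where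
  "vanishes_mod p n x f \<longleftrightarrow> (\<exists>g. [:p:] dvd f - [:- x, 1:] ^ n * g)"

lemma vanishes_mod_0: "vanishes_mod p 0 x f"
  unfolding vanishes_mod_def by (rule exI[of _ f]) simp

lemma vanishes_mod_mono:
  assumes "vanishes_mod p n x f" "m \<le> n"
  shows "vanishes_mod p m x f"
proof -
  obtain g where "[:p:] dvd f - [:- x, 1:] ^ n * g"
    using assms(1) by (auto simp: vanishes_mod_def)
  moreover have "[:- x, 1:] ^ n * g = [:- x, 1:] ^ m * ([:- x, 1:] ^ (n - m) * g)"
    using assms(2) by (simp flip: power_add mult.assoc)
  ultimately show ?thesis
    unfolding vanishes_mod_def by metis
qed

lemma vanishes_mod_diff:
  assumes "vanishes_mod p n x f" "vanishes_mod p n x g"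
  shows "vanishes_mod p n x (f - g)"
proof -
  obtain f' g' where "[:p:] dvd f - [:- x, 1:] ^ n * f'" "[:p:] dvd g - [:- x, 1:] ^ n * g'"
    using assms by (auto simp: vanishes_mod_def)
  then have "[:p:] dvd (f - [:- x, 1:] ^ n * f') - (g - [:- x, 1:] ^ n * g')"
    by (rule dvd_diff)
  also have "\<dots> = (f - g) - [:- x, 1:] ^ n * (f' - g')"
    by (simp add: algebra_simps)
  finally show ?thesis
    unfolding vanishes_mod_def ..
qed

lemma vanishes_mod_smult:
  assumes "vanishes_mod p n x f"
  shows "vanishes_mod p n x (smult c f)"
proof -
  obtain g where "[:p:] dvd f - [:- x, 1:] ^ n * g"
    using assms by (auto simp: vanishes_mod_def)
  then have "[:p:] dvd [:c:] * (f - [:- x, 1:] ^ n * g)"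
    by (rule dvd_mult)
  also have "\<dots> = smult c f - [:- x, 1:] ^ n * smult c g"
    by (simp add: algebra_simps smult_diff_right)
  finally show ?thesis
    unfolding vanishes_mod_def ..
qed

lemma vanishes_mod_root:
  assumes "vanishes_mod p n x f" "n > 0"
  shows "p dvd poly f x"
proof -
  obtain g where "[:p:] dvd f - [:- x, 1:] ^ n * g"
    using assms(1) by (auto simp: vanishes_mod_def)
  from const_dvd_imp_dvd_poly[OF this, of x] show ?thesis
    using assms(2) by (simp add: power_0_left)
qed

lemma vanishes_mod_Suc:
  fixes p :: int
  assumes "[:p:] dvd f - [:- x, 1:] ^ n * g" and "p dvd poly g x"
  shows "\<exists>h. [:p:] dvd f - [:- x, 1:] ^ Suc n * h"
proof -
  obtain h where h: "g = [:- x, 1:] * h + [:poly g x:]"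
    using split_off_root[of g x] by blast
  have "f - [:- x, 1:] ^ Suc n * h
      = (f - [:- x, 1:] ^ n * g) + [:- x, 1:] ^ n * (g - [:- x, 1:] * h)"
    by (simp add: algebra_simps)
  moreover have "g - [:- x, 1:] * h = [:poly g x:]"
    using h by (metis add_diff_cancel_left')
  moreover have "[:p:] dvd [:poly g x:]"
    using assms(2) by simp
  ultimately have "[:p:] dvd f - [:- x, 1:] ^ Suc n * h"
    using assms(1) by (metis dvd_add dvd_mult)
  then show ?thesis ..
qed

text \<open>
  The factors \<open>(X - y) ^ n\<close> can be collected one point and one linear factor at a time: if \<open>f\<close> is
  congruent to both \<open>Q (X - y) ^ j h\<close> and \<open>(X - y) ^ n q\<close> with \<open>j < n\<close> and \<open>Q\<close> does not vanish at
  \<open>y\<close>, then cancelling \<open>(X - y) ^ j\<close> shows that \<open>h\<close> vanishes at \<open>y\<close>.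
\<close>

lemma combine_zeros_mod:
  fixes p :: int
  assumes p: "prime p" and "finite S"
    and "\<And>x y. x \<in> S \<Longrightarrow> y \<in> S \<Longrightarrow> x \<noteq> y \<Longrightarrow> \<not> p dvd x - y"
    and "\<And>x. x \<in> S \<Longrightarrow> vanishes_mod p n x f"
  shows "\<exists>g. [:p:] dvd f - (\<Prod>x\<in>S. [:- x, 1:] ^ n) * g"
  using assms(2-)
proof (induction S rule: finite_induct)
  case empty
  show ?case by (rule exI[of _ f]) simp
next
  case (insert y S)
  define Q where "Q = (\<Prod>x\<in>S. [:- x, 1:] ^ n)"
  obtain g where g: "[:p:] dvd f - Q * g"
    using insert unfolding Q_def by blast
  obtain q where q: "[:p:] dvd f - [:- y, 1:] ^ n * q"
    using insert.prems(2)[of y] by (auto simp: vanishes_mod_def)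
  have Qy: "\<not> p dvd poly Q y"
  proof
    assume "p dvd poly Q y"
    then have "p dvd (\<Prod>x\<in>S. (y - x) ^ n)"
      by (simp add: Q_def poly_prod)
    then obtain x where "x \<in> S" "p dvd y - x"
      using p insert.hyps(1) by (auto simp: prime_dvd_prod_iff dest: prime_dvd_power)
    then show False
      using insert.prems(1)[of y x] insert.hyps(2) by auto
  qed
  have "\<exists>h. [:p:] dvd f - Q * [:- y, 1:] ^ j * h" if "j \<le> n" for j
    using that
  proof (induction j)
    case 0
    show ?case using g by auto
  next
    case (Suc j)
    then obtain h where h: "[:p:] dvd f - Q * [:- y, 1:] ^ j * h"
      by auto
    have split: "[:- y, 1:] ^ n = [:- y, 1:] ^ j * [:- y, 1:] ^ (n - j)"
      using Suc.prems by (simp flip: power_add)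
    have "[:p:] dvd (f - [:- y, 1:] ^ n * q) - (f - Q * [:- y, 1:] ^ j * h)"
      using q h by (rule dvd_diff)
    also have "(f - [:- y, 1:] ^ n * q) - (f - Q * [:- y, 1:] ^ j * h)
        = [:- y, 1:] ^ j * (Q * h - [:- y, 1:] ^ (n - j) * q)"
      by (simp add: split algebra_simps)
    finally have "[:p:] dvd Q * h - [:- y, 1:] ^ (n - j) * q"
      using const_prime_dvd_mult[OF p] const_not_dvd_linear_power[OF p] by blast
    then have "p dvd poly (Q * h - [:- y, 1:] ^ (n - j) * q) y"
      by (rule const_dvd_imp_dvd_poly)
    then have "p dvd poly Q y * poly h y"
      using Suc.prems by (simp add: power_0_left)
    then have hy: "p dvd poly h y"
      using p Qy by (simp add: prime_dvd_mult_iff)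
    obtain k where k: "h = [:- y, 1:] * k + [:poly h y:]"
      using split_off_root[of h y] by blast
    have "h - [:- y, 1:] * k = [:poly h y:]"
      using k by (metis add_diff_cancel_left')
    then have "[:p:] dvd h - [:- y, 1:] * k"
      using hy by simp
    then have "[:p:] dvd (f - Q * [:- y, 1:] ^ j * h) + Q * [:- y, 1:] ^ j * (h - [:- y, 1:] * k)"
      using h by (intro dvd_add dvd_mult)
    also have "(f - Q * [:- y, 1:] ^ j * h) + Q * [:- y, 1:] ^ j * (h - [:- y, 1:] * k)
        = f - Q * [:- y, 1:] ^ Suc j * k"
      by (simp add: algebra_simps)
    finally show ?case ..
  qed
  from this[of n] show ?case
    using insert.hyps by (simp add: Q_def mult_ac)
qed

text \<open>
  The coefficients of \<open>g\<close> may be multiples of \<open>p\<close> in high degrees, so its leading coefficient says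
  nothing. Instead one compares coefficients at \<open>degree Q + m\<close>, where \<open>m\<close> is the degree of
  \<open>g\<close> after reduction modulo \<open>p\<close>.
\<close>

lemma degree_le_of_dvd_mod:
  fixes p :: int
  assumes p: "prime p" and f: "\<not> [:p:] dvd f" and fQ: "[:p:] dvd f - Q * g"
    and Q: "lead_coeff Q = 1"
  shows "degree Q \<le> degree f"
proof (rule ccontr)
  assume "\<not> degree Q \<le> degree f"
  then have less: "degree f < degree Q" by simp
  have "\<not> [:p:] dvd g"
    using f fQ by (metis diff_add_cancel dvd_add dvd_mult)
  then obtain k where "\<not> p dvd coeff g k"
    by (auto simp: const_poly_dvd_iff)
  moreover have "k \<le> degree g" if "\<not> p dvd coeff g k" for k
    using that by (metis coeff_eq_0 dvd_0_right not_le_imp_less)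
  ultimately obtain m where m: "\<not> p dvd coeff g m"
    and max: "\<And>k. \<not> p dvd coeff g k \<Longrightarrow> k \<le> m"
    using Nat.ex_has_greatest_nat[of "\<lambda>k. \<not> p dvd coeff g k" k "degree g"] by blast
  have "p dvd coeff Q i * coeff g (degree Q + m - i)" if "i \<noteq> degree Q" for i
  proof (cases "i < degree Q")
    case True
    then have "\<not> degree Q + m - i \<le> m" by simp
    then show ?thesis using max by (meson dvd_mult)
  next
    case False
    then show ?thesis using that by (simp add: coeff_eq_0)
  qed
  then have "p dvd (\<Sum>i\<in>{..degree Q + m} - {degree Q}. coeff Q i * coeff g (degree Q + m - i))"
    by (intro dvd_sum) auto
  moreover have "coeff (Q * g) (degree Q + m)
      = coeff g m + (\<Sum>i\<in>{..degree Q + m} - {degree Q}. coeff Q i * coeff g (degree Q + m - i))"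
    unfolding coeff_mult using Q by (subst sum.remove[of _ "degree Q"]) auto
  moreover have "p dvd coeff (Q * g) (degree Q + m)"
  proof -
    have "p dvd coeff (f - Q * g) (degree Q + m)"
      using fQ by (simp add: const_poly_dvd_iff)
    then show ?thesis
      using less by (simp add: coeff_eq_0)
  qed
  ultimately show False
    using m by (simp add: dvd_add_left_iff)
qed

lemma zeros_mod_le_degree:
  fixes p :: int
  assumes "prime p" and "finite S" and "\<not> [:p:] dvd f"
    and "\<And>x y. x \<in> S \<Longrightarrow> y \<in> S \<Longrightarrow> x \<noteq> y \<Longrightarrow> \<not> p dvd x - y"
    and "\<And>x. x \<in> S \<Longrightarrow> vanishes_mod p n x f"
  shows "n * card S \<le> degree f"
proof -
  define Q where "Q = (\<Prod>x\<in>S. [:- x, 1:] ^ n)"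
  have "lead_coeff Q = 1"
    by (simp add: Q_def lead_coeff_prod lead_coeff_power)
  moreover have "degree Q = n * card S"
    unfolding Q_def by (subst degree_prod_eq_sum_degree) (auto simp: degree_linear_power mult.commute)
  moreover obtain g where "[:p:] dvd f - Q * g"
    using combine_zeros_mod[OF assms(1,2,4,5)] unfolding Q_def by blast
  ultimately show ?thesis
    using degree_le_of_dvd_mod[OF assms(1,3)] by metis
qed

lemma vanishes_mod_1: "p dvd poly f x \<Longrightarrow> vanishes_mod p 1 x f"
  using vanishes_mod_Suc[of p f x 0 f] by (simp add: vanishes_mod_def)

section \<open>Multiplicities from derivatives\<close>

text \<open>
  The derivation \<open>w d/dX\<close>. With a suitable weight \<open>w\<close> it acts diagonally on the monomials
  (\<open>w = X\<close>), or preserves the multiples of \<open>X ^ m (X + h) ^ n\<close> (\<open>w = X (X + h)\<close>).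
\<close>

definition derive_along :: "int poly \<Rightarrow> int poly \<Rightarrow> int poly" where
  "derive_along w f = w * pderiv f"

lemma derive_along_linear_power_mult:
  "derive_along w ([:- x, 1:] ^ Suc n * g)
    = [:- x, 1:] ^ n * (smult (of_nat (Suc n)) (w * g) + [:- x, 1:] * derive_along w g)"
  unfolding derive_along_def pderiv_mult pderiv_power_Suc
  by (simp add: pderiv_pCons algebra_simps)

lemma derive_along_diff: "derive_along w (f - g) = derive_along w f - derive_along w g"
  by (simp add: derive_along_def pderiv_diff algebra_simps)

lemma funpow_derive_along_diff:
  "(derive_along w ^^ k) (f - g) = (derive_along w ^^ k) f - (derive_along w ^^ k) g"
  by (induction k) (simp_all add: derive_along_diff)

lemma funpow_derive_along_const_dvd:
  assumes "[:p:] dvd f"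
  shows "[:p:] dvd (derive_along w ^^ k) f"
proof (induction k)
  case (Suc k)
  then obtain g where "(derive_along w ^^ k) f = [:p:] * g" ..
  then have "(derive_along w ^^ Suc k) f = [:p:] * derive_along w g"
    by (simp add: derive_along_def[of w "smult _ _"] pderiv_smult) (simp add: derive_along_def)
  then show ?case ..
qed (use assms in simp)

lemma poly_funpow_derive_along_power:
  "poly ((derive_along w ^^ k) ([:- x, 1:] ^ k * g)) x = fact k * poly w x ^ k * poly g x"
proof (induction k arbitrary: g)
  case (Suc k)
  define g' where "g' = smult (of_nat (Suc k)) (w * g) + [:- x, 1:] * derive_along w g"
  have "derive_along w ([:- x, 1:] ^ Suc k * g) = [:- x, 1:] ^ k * g'"
    unfolding g'_def by (rule derive_along_linear_power_mult)
  then have "(derive_along w ^^ Suc k) ([:- x, 1:] ^ Suc k * g)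
      = (derive_along w ^^ k) ([:- x, 1:] ^ k * g')"
    by (simp add: funpow_swap1 del: power_Suc)
  then have "poly ((derive_along w ^^ Suc k) ([:- x, 1:] ^ Suc k * g)) x
      = fact k * poly w x ^ k * poly g' x"
    using Suc.IH by simp
  then show ?case
    by (simp add: g'_def algebra_simps)
qed simp

text \<open>
  Applying the derivation \<open>m\<close> times to \<open>(X - x) ^ m g\<close> gives \<open>m! w(x) ^ m g(x)\<close> at \<open>x\<close>; for \<open>m < p\<close>
  the factorial is a unit modulo \<open>p\<close>, so one more vanishing derivative means one more factor
  \<open>X - x\<close>.
\<close>

lemma vanishes_mod_of_derivatives:
  fixes p :: int
  assumes p: "prime p" and w: "\<not> p dvd poly w x" and n: "int n \<le> p"
    and der: "\<And>k. k < n \<Longrightarrow> p dvd poly ((derive_along w ^^ k) f) x"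
  shows "vanishes_mod p n x f"
proof -
  have "vanishes_mod p m x f" if "m \<le> n" for m
    using that
  proof (induction m)
    case 0
    show ?case by (rule vanishes_mod_0)
  next
    case (Suc m)
    then obtain g where g: "[:p:] dvd f - [:- x, 1:] ^ m * g"
      by (auto simp: vanishes_mod_def)
    have "p dvd poly ((derive_along w ^^ m) (f - [:- x, 1:] ^ m * g)) x"
      by (intro const_dvd_imp_dvd_poly funpow_derive_along_const_dvd g)
    then have "p dvd poly ((derive_along w ^^ m) f) x - fact m * poly w x ^ m * poly g x"
      by (simp add: funpow_derive_along_diff poly_funpow_derive_along_power)
    then have "p dvd fact m * poly w x ^ m * poly g x"
      using der[of m] Suc.prems by (simp add: dvd_diff_right_iff)
    moreover have "\<not> p dvd fact m"
    proof
      assume "p dvd fact m"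
      then have "int (nat p) dvd int (fact m)" using p prime_ge_0_int by simp
      then have "nat p dvd fact m" by presburger
      then have "nat p \<le> m" 
        using p prime_dvd_fact_iff prime_int_nat_transfer by blast
      then show False using n Suc.prems by linarith
    qed
    ultimately have "p dvd poly g x"
      using p w by (auto simp: prime_dvd_mult_iff dest: prime_dvd_power)
    then show ?case
      using vanishes_mod_Suc[OF g] by (simp add: vanishes_mod_def)
  qed
  then show ?thesis by simp
qed

lemma vanishes_mod_derive_along:
  assumes "vanishes_mod p (Suc n) x f"
  shows "vanishes_mod p n x (derive_along w f)"
proof -
  obtain g where "[:p:] dvd f - [:- x, 1:] ^ Suc n * g"
    using assms by (auto simp: vanishes_mod_def)
  then have "[:p:] dvd derive_along w (f - [:- x, 1:] ^ Suc n * g)"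
    using funpow_derive_along_const_dvd[where k = 1] by simp
  then show ?thesis
    unfolding derive_along_diff derive_along_linear_power_mult vanishes_mod_def by blast
qed

section \<open>Sparse polynomials modulo a prime\<close>

lemma derive_along_monom: "derive_along [:0, 1:] (monom c e) = monom (of_nat e * c) e"
proof -
  have "[:0, 1:] * monom (of_nat e * c) (e - 1) = monom (of_nat e * c) e"
    by (cases e) (simp_all add: monom_Suc)
  then show ?thesis
    by (simp only: derive_along_def pderiv_monom)
qed

lemma derive_along_sum: "derive_along w (\<Sum>i\<in>I. f i) = (\<Sum>i\<in>I. derive_along w (f i))"
  by (induction I rule: infinite_finite_induct)
    (simp_all add: derive_along_def pderiv_add distrib_left)

lemma smult_sum_right: "smult c (\<Sum>i\<in>I. f i) = (\<Sum>i\<in>I. smult c (f i))"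
  by (induction I rule: infinite_finite_induct) (simp_all add: smult_add_right)

text \<open>
  A form of Descartes' rule modulo \<open>p\<close>. For each exponent \<open>e0\<close> the operator \<open>X d/dX - e0\<close> removes
  the term of degree \<open>e0\<close>, multiplies the coefficient at any other exponent \<open>e\<close> by
  \<open>e - e0\<close>, which is a unit because the exponents are less than \<open>p\<close>, and lowers the order of
  vanishing by at most one. So the number of terms and the order decrease together until one term
  is left, and that term cannot vanish at \<open>h\<close>.
\<close>

lemma sparse_poly_vanishing_mod:
  fixes p :: int
  assumes p: "prime p" and h: "\<not> p dvd h" and "finite E"
    and "\<And>e. e \<in> E \<Longrightarrow> int e < p"
    and "vanishes_mod p (card E) h (\<Sum>e\<in>E. monom (u e) e)"
  shows "\<forall>e\<in>E. p dvd u e"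
  using assms(3-)
proof (induction E arbitrary: u rule: finite_induct)
  case (insert e0 E)
  define F where "F = (\<Sum>e\<in>insert e0 E. monom (u e) e)"
  define v where "v e = (int e - int e0) * u e" for e
  have F: "vanishes_mod p (Suc (card E)) h F"
    using insert by (simp add: F_def)
  have "derive_along [:0, 1:] F - smult (int e0) F = (\<Sum>e\<in>insert e0 E. monom (v e) e)"
    by (simp only: F_def derive_along_sum derive_along_monom smult_sum_right smult_monom diff_monom
        v_def left_diff_distrib flip: sum_subtractf)
  also have "\<dots> = (\<Sum>e\<in>E. monom (v e) e)"
    using insert.hyps by (simp add: v_def)
  finally have "(\<Sum>e\<in>E. monom (v e) e) = derive_along [:0, 1:] F - smult (int e0) F" ..
  moreover have "vanishes_mod p (card E) h \<dots>"
    using F by (intro vanishes_mod_diff vanishes_mod_derive_along vanishes_mod_smult)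
      (auto intro: vanishes_mod_mono)
  ultimately have "\<forall>e\<in>E. p dvd v e"
    using insert.IH[of v] insert.prems(1) by simp
  have E: "p dvd u e" if "e \<in> E" for e
  proof -
    have "\<not> p dvd int e - int e0"
    proof
      assume "p dvd int e - int e0"
      moreover have "int e - int e0 \<noteq> 0"
        using that insert.hyps by auto
      ultimately have "\<bar>p\<bar> \<le> \<bar>int e - int e0\<bar>"
        by (rule dvd_imp_le_int[rotated])
      moreover have "int e < p" "int e0 < p"
        using insert.prems(1) that by auto
      ultimately show False by linarith
    qed
    then show ?thesis
      using \<open>\<forall>e\<in>E. p dvd v e\<close> that p by (auto simp: v_def prime_dvd_mult_iff)
  qed
  have "p dvd poly F h"
    using F by (rule vanishes_mod_root) simp
  also have "poly F h = u e0 * h ^ e0 + (\<Sum>e\<in>E. u e * h ^ e)"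
    using insert.hyps by (simp add: F_def poly_sum poly_monom)
  finally have "p dvd u e0 * h ^ e0"
    using E by (subst (asm) dvd_add_left_iff) (auto intro!: dvd_sum)
  then have "p dvd u e0"
    using p h by (auto simp: prime_dvd_mult_iff dest: prime_dvd_power)
  with E show ?case by blast
qed simp

text \<open>
  Collect the terms with the same power of \<open>X + h\<close>. If some coefficient were nonzero modulo \<open>p\<close>,
  take the lowest power \<open>(X + h) ^ (t j)\<close> with a nonzero cofactor \<open>F\<^sub>j\<close>. All later terms contain
  \<open>t\<close> further factors \<open>X + h\<close>, so \<open>F\<^sub>j\<close> vanishes to order \<open>t\<close> at \<open>- h\<close> although it has at most \<open>t\<close>
  terms.
\<close>

lemma two_variable_independence:
  fixes p :: int
  assumes p: "prime p" and h: "\<not> p dvd h" and E: "finite E" "card E \<le> t"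
    and E_less: "\<And>e. e \<in> E \<Longrightarrow> int e < p"
    and zero: "[:p:] dvd (\<Sum>i\<in>{..<B}\<times>E. smult (u i) ([:0, 1:] ^ snd i * [:h, 1:] ^ (t * fst i)))"
  shows "\<forall>i\<in>{..<B}\<times>E. p dvd u i"
proof (rule ccontr)
  define F where "F j = (\<Sum>e\<in>E. monom (u (j, e)) e)" for j
  define g where "g = [:h, 1:]"
  assume "\<not> (\<forall>i\<in>{..<B}\<times>E. p dvd u i)"
  then have "\<exists>j. j < B \<and> (\<exists>e\<in>E. \<not> p dvd u (j, e))"
    by auto
  then obtain j where j: "j < B \<and> (\<exists>e\<in>E. \<not> p dvd u (j, e))"
    and min: "\<And>i. i < j \<Longrightarrow> \<not> (i < B \<and> (\<exists>e\<in>E. \<not> p dvd u (i, e)))"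
    by (rule exists_least_iff[THEN iffD1, THEN exE]) blast
  define H where "H = (\<Sum>i\<in>{j<..<B}. g ^ (t * (i - Suc j)) * F i)"
  have "(\<Sum>i\<in>{..<B}\<times>E. smult (u i) ([:0, 1:] ^ snd i * [:h, 1:] ^ (t * fst i)))
      = (\<Sum>i<B. g ^ (t * i) * F i)"
    by (simp add: F_def g_def sum_distrib_left monom_altdef mult_ac sum.cartesian_product case_prod_unfold)
  also have "\<dots> = (\<Sum>i\<in>{..<j} \<union> {j} \<union> {j<..<B}. g ^ (t * i) * F i)"
    by (rule arg_cong[of _ _ "sum _"]) (use j in auto)
  also have "(\<Sum>i\<in>{..<j} \<union> {j} \<union> {j<..<B}. g ^ (t * i) * F i)
      = (\<Sum>i<j. g ^ (t * i) * F i) + g ^ (t * j) * F j + (\<Sum>i\<in>{j<..<B}. g ^ (t * i) * F i)"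
    by (subst sum.union_disjoint; auto)+
  also have "(\<Sum>i\<in>{j<..<B}. g ^ (t * i) * F i) = g ^ (t * j) * (g ^ t * H)"
  proof -
    have "g ^ (t * i) = g ^ (t * j) * (g ^ t * g ^ (t * (i - Suc j)))" if "i \<in> {j<..<B}" for i
    proof -
      have "t * i = t * j + (t + t * (i - Suc j))"
        using that by (auto simp: greaterThanLessThan_iff dest!: less_imp_Suc_add simp: algebra_simps)
      then show ?thesis by (simp add: power_add)
    qed
    then show ?thesis
      by (simp add: H_def sum_distrib_left mult.assoc)
  qed
  also have "(\<Sum>i<j. g ^ (t * i) * F i) + g ^ (t * j) * F j + g ^ (t * j) * (g ^ t * H)
      = (\<Sum>i<j. g ^ (t * i) * F i) + g ^ (t * j) * (F j + g ^ t * H)"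
    by (simp add: algebra_simps)
  finally have "[:p:] dvd (\<Sum>i<j. g ^ (t * i) * F i) + g ^ (t * j) * (F j + g ^ t * H)"
    using zero by simp
  moreover have "[:p:] dvd (\<Sum>i<j. g ^ (t * i) * F i)"
  proof (intro dvd_sum dvd_mult)
    fix i assume "i \<in> {..<j}"
    then have "p dvd u (i, e)" if "e \<in> E" for e
      using min[of i] j that by auto
    then show "[:p:] dvd F i"
      unfolding F_def by (intro dvd_sum) (auto simp: const_poly_dvd_iff)
  qed
  ultimately have "[:p:] dvd g ^ (t * j) * (F j + g ^ t * H)"
    by (simp add: dvd_add_right_iff)
  then have "[:p:] dvd F j + g ^ t * H"
    using const_prime_dvd_mult[OF p] const_not_dvd_linear_power[OF p, of "- h" "t * j"]
    unfolding g_def by fastforce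
  then have "[:p:] dvd F j - [:- (- h), 1:] ^ t * (- H)"
    by (simp add: g_def)
  then have "vanishes_mod p t (- h) (F j)"
    unfolding vanishes_mod_def by blast
  then have "vanishes_mod p (card E) (- h) (F j)"
    using E(2) by (rule vanishes_mod_mono)
  then have "\<forall>e\<in>E. p dvd u (j, e)"
    using h E(1) E_less p unfolding F_def by (intro sparse_poly_vanishing_mod[where h = "- h"]) auto
  then show False
    using j by blast
qed

section \<open>The intersection of a subgroup with its shift\<close>

text \<open>
  Pigeonhole principle: there are more vectors with entries in \<open>[0, p)\<close> than possible
  right-hand sides, so two of them have the same image, and their difference is in the kernel.
\<close>

lemma exists_nonzero_kernel_mod:
  fixes M :: "'j \<Rightarrow> 'i \<Rightarrow> int"
  assumes "finite I" "finite J" "card J < card I" "p > 1"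
  shows "\<exists>u. (\<exists>i\<in>I. \<not> p dvd u i) \<and> (\<forall>j\<in>J. p dvd (\<Sum>i\<in>I. u i * M j i))"
proof -
  define U where "U = I \<rightarrow>\<^sub>E {0..<p}"
  define V where "V = J \<rightarrow>\<^sub>E {0..<p}"
  define \<phi> where "\<phi> u = (\<lambda>j\<in>J. (\<Sum>i\<in>I. u i * M j i) mod p)" for u
  have "finite V" "card V < card U"
    using assms by (auto simp: U_def V_def card_PiE finite_PiE)
  moreover have "\<phi> ` U \<subseteq> V"
    using assms(4) by (auto simp: \<phi>_def V_def)
  ultimately have "\<not> inj_on \<phi> U"
    using card_inj_on_le linorder_not_less by blast
  then obtain u v where uv: "u \<in> U" "v \<in> U" "u \<noteq> v" "\<phi> u = \<phi> v"
    by (auto simp: inj_on_def)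
  obtain i where i: "i \<in> I" "u i \<noteq> v i"
    using uv PiE_ext[of u I _ v] unfolding U_def by blast
  have "u i \<in> {0..<p}" "v i \<in> {0..<p}"
    using uv i unfolding U_def by blast+
  then have "\<not> p dvd u i - v i"
    using i by (auto simp flip: mod_eq_dvd_iff)
  moreover have "p dvd (\<Sum>i\<in>I. (u i - v i) * M j i)" if "j \<in> J" for j
  proof -
    have "(\<Sum>i\<in>I. u i * M j i) mod p = (\<Sum>i\<in>I. v i * M j i) mod p"
      using fun_cong[OF uv(4), of j] that by (simp add: \<phi>_def)
    then have "p dvd (\<Sum>i\<in>I. u i * M j i) - (\<Sum>i\<in>I. v i * M j i)"
      by (simp add: mod_eq_dvd_iff)
    then show ?thesis
      by (simp add: sum_subtractf left_diff_distrib)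
  qed
  ultimately show ?thesis
    using i by (intro exI[of _ "\<lambda>i. u i - v i"]) blast
qed

lemma mult_pderiv_power: "q * pderiv (q ^ n) = smult (of_nat n) (q ^ n * pderiv q)"
  for q :: "int poly"
  by (cases n) (simp_all add: pderiv_power_Suc mult_ac del: of_nat_Suc power_Suc, simp add: mult_ac)

text \<open>
  The logarithmic derivative of \<open>X ^ m (X + h) ^ n\<close> is \<open>m / X + n / (X + h)\<close>; the weight
  \<open>X (X + h)\<close> clears its denominators.
\<close>

lemma derive_along_powers:
  fixes h :: int
  shows "derive_along ([:0, 1:] * [:h, 1:]) ([:0, 1:] ^ m * [:h, 1:] ^ n)
    = (smult (int m) [:h, 1:] + smult (int n) [:0, 1:]) * ([:0, 1:] ^ m * [:h, 1:] ^ n)"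
proof -
  have "derive_along ([:0, 1:] * [:h, 1:]) ([:0, 1:] ^ m * [:h, 1:] ^ n)
      = [:h, 1:] * [:h, 1:] ^ n * ([:0, 1:] * pderiv ([:0, 1:] ^ m))
        + [:0, 1:] * [:0, 1:] ^ m * ([:h, 1:] * pderiv ([:h, 1:] ^ n))"
    unfolding derive_along_def pderiv_mult by (simp only: algebra_simps)
  then show ?thesis
    unfolding mult_pderiv_power by (simp add: pderiv_pCons algebra_simps smult_add_left)
qed

lemma funpow_derive_along_conj:
  assumes "derive_along w G = v * G"
  shows "(derive_along w ^^ k) (G * R) = G * ((\<lambda>R. v * R + derive_along w R) ^^ k) R"
proof (induction k)
  case (Suc k)
  have "derive_along w (G * Q) = G * (v * Q + derive_along w Q)" for Q
    using assms by (simp add: derive_along_def pderiv_mult algebra_simps)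
  with Suc show ?case by simp
qed simp

lemma degree_funpow_twisted:
  assumes "degree v \<le> 1" "degree w \<le> 2"
  shows "degree (((\<lambda>R. v * R + derive_along w R) ^^ k) R) \<le> degree R + k"
proof (induction k)
  case (Suc k)
  define Q where "Q = ((\<lambda>R. v * R + derive_along w R) ^^ k) R"
  have "degree (v * Q) \<le> Suc (degree Q)"
    using degree_mult_le[of v Q] assms by linarith
  moreover have "degree (derive_along w Q) \<le> Suc (degree Q)"
  proof (cases "degree Q = 0")
    case True
    then show ?thesis by (auto simp: derive_along_def elim!: degree_eq_zeroE)
  next
    case False
    then show ?thesis
      using degree_mult_le[of w "pderiv Q"] assms(2)
      by (simp add: derive_along_def degree_pderiv)
  qed
  ultimately show ?case
    using Suc degree_add_le[of "v * Q" "Suc (degree Q)"] by (fastforce simp flip: Q_def)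
qed simp

lemma funpow_derive_along_sum:
  "(derive_along w ^^ k) (\<Sum>i\<in>I. smult (c i) (f i)) = (\<Sum>i\<in>I. smult (c i) ((derive_along w ^^ k) (f i)))"
  by (induction k) (simp_all add: derive_along_sum derive_along_def[of w "smult _ _"] pderiv_smult,
    simp add: derive_along_def)

text \<open>
  The exponents \<open>a + t c\<close> with \<open>a < A\<close> and \<open>c < B\<close>, described through \<open>a = e mod t\<close> and
  \<open>c = e div t\<close>.
\<close>

lemma card_residue_block:
  fixes t A B :: nat
  assumes "A \<le> t"
  shows "card {e. e < t * B \<and> e mod t < A} = B * A"
proof -
  have "bij_betw (\<lambda>(c, a). t * c + a) ({..<B} \<times> {..<A}) {e. e < t * B \<and> e mod t < A}"
  proof (rule bij_betw_byWitness[where f' = "\<lambda>e. (e div t, e mod t)"])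
    have "t * c + a < t * B" if "c < B" "a < A" for c a
    proof -
      have "t * c + a < t * Suc c" using that assms by simp
      also have "\<dots> \<le> t * B" using that by (intro mult_le_mono2) simp
      finally show ?thesis .
    qed
    then show "(\<lambda>(c, a). t * c + a) ` ({..<B} \<times> {..<A}) \<subseteq> {e. e < t * B \<and> e mod t < A}"
      using assms by auto
    show "(\<lambda>e. (e div t, e mod t)) ` {e. e < t * B \<and> e mod t < A} \<subseteq> {..<B} \<times> {..<A}"
      by (auto simp: less_mult_imp_div_less mult.commute)
  qed (use assms in auto)
  then show ?thesis
    using bij_betw_same_card by fastforce
qed

lemma degree_sum_smult_le:
  assumes "\<And>i. i \<in> I \<Longrightarrow> degree (f i) \<le> n"
  shows "degree (\<Sum>i\<in>I. smult (c i :: int) (f i)) \<le> n"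
  using assms
  by (induction I rule: infinite_finite_induct) (auto intro!: degree_add_le order_trans[OF degree_smult_le])

text \<open>
  Stepanov's method. The unknown polynomial \<open>\<Psi>\<close> has \<open>A B\<^sup>2\<close> terms
  \<open>X ^ (a + t c) (X + h) ^ (t j)\<close> with \<open>a < A\<close> and \<open>c, j < B\<close>. Its \<open>k\<close>-th derivative along
  \<open>X (X + h)\<close> agrees on \<open>S\<close> with a polynomial of degree less than \<open>A + k\<close>, so vanishing to order \<open>D\<close> on \<open>S\<close>
  costs at most \<open>D (A + D)\<close> linear equations. With \<open>A = 4 b\<^sup>2\<close>, \<open>B = 2 b\<close> and \<open>D = 2 b\<^sup>2\<close> these are
  \<open>12 b ^ 4\<close> equations for \<open>16 b ^ 4\<close> unknowns. The degree of \<open>\<Psi>\<close> is at most \<open>2 t B = 4 b t\<close>,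
  whence \<open>D card S \<le> 4 b t\<close>. The condition \<open>8 b\<^sup>3 \<le> t\<close> says that each power of \<open>X + h\<close>
  has a cofactor with \<open>A B \<le> t\<close> terms, and \<open>2 b t \<le> p\<close> keeps their exponents below \<open>p\<close>.
\<close>

lemma shifted_subgroup_intersection:
  fixes p h :: int and t b :: nat
  assumes p: "prime p" and h: "\<not> p dvd h" and b: "0 < b" "8 * b ^ 3 \<le> t" "int (2 * b * t) \<le> p"
    and S: "finite S" "\<And>x y. x \<in> S \<Longrightarrow> y \<in> S \<Longrightarrow> x \<noteq> y \<Longrightarrow> \<not> p dvd x - y"
    and root: "\<And>x. x \<in> S \<Longrightarrow> p dvd x ^ t - 1" "\<And>x. x \<in> S \<Longrightarrow> p dvd (x + h) ^ t - 1"
  shows "b * card S \<le> 2 * t"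
proof -
  \<comment> \<open>\<open>m i\<close> is the term with index \<open>i = (j, a + t c)\<close>, \<open>G i\<close> its part that equals \<open>1\<close> on \<open>S\<close>,
    \<open>v i\<close> the weighted logarithmic derivative of \<open>G i\<close>, and \<open>G i * R k i\<close> the \<open>k\<close>-th derivative
    of \<open>m i\<close>.\<close>
  define A B D where "A = 4 * b ^ 2" and "B = 2 * b" and "D = 2 * b ^ 2"
  define E where "E = {e. e < t * B \<and> e mod t < A}"
  define I where "I = {..<B} \<times> E"
  define J where "J = {..<D} \<times> {..<A + D}"
  define w where "w = [:0, 1:] * [:h, 1:]"
  define v where "v i = smult (int (t * (snd i div t))) [:h, 1:] + smult (int (t * fst i)) [:0, 1:]"
    for i :: "nat \<times> nat"
  define R where "R k i = ((\<lambda>R. v i * R + derive_along w R) ^^ k) ([:0, 1:] ^ (snd i mod t))"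
    for k i
  define G where "G i = [:0, 1:] ^ (t * (snd i div t)) * [:h, 1:] ^ (t * fst i)"
    for i :: "nat \<times> nat"
  define m where "m i = [:0, 1:] ^ snd i * [:h, 1:] ^ (t * fst i)" for i :: "nat \<times> nat"
  have "b \<le> b ^ 2" "b ^ 2 \<le> b ^ 3"
    using b(1) by (auto simp: power2_eq_square power3_eq_cube)
  then have "A \<le> t" "D \<le> t" "0 < t"
    using b by (auto simp: A_def D_def)
  have "t \<le> 2 * b * t" using b(1) by simp
  then have "int D \<le> p"
    using \<open>D \<le> t\<close> b(3) by linarith
  have "finite E"
    by (auto simp: E_def)
  have cardE: "card E = 8 * b ^ 3"
    unfolding E_def card_residue_block[OF \<open>A \<le> t\<close>]
    by (simp add: A_def B_def power2_eq_square power3_eq_cube)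
  have "card J < card I"
    using b(1) by (simp add: I_def J_def cardE card_cartesian_product A_def B_def D_def power2_eq_square power3_eq_cube)
  then obtain u where u: "\<exists>i\<in>I. \<not> p dvd u i"
    and ker: "\<forall>j\<in>J. p dvd (\<Sum>i\<in>I. u i * (case j of (k, n) \<Rightarrow> coeff (R k i) n))"
    using exists_nonzero_kernel_mod[of I J p "\<lambda>j i. case j of (k, n) \<Rightarrow> coeff (R k i) n"]
      \<open>finite E\<close> prime_gt_1_int[OF p] by (auto simp: I_def J_def)
  define \<Psi> where "\<Psi> = (\<Sum>i\<in>I. smult (u i) (m i))"
  have "\<not> [:p:] dvd \<Psi>"
  proof
    assume "[:p:] dvd \<Psi>"
    moreover have "int e < p" if "e \<in> E" for e
    proof -
      have "e < 2 * b * t"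
        using that by (simp add: E_def B_def mult_ac)
      then show ?thesis using b(3) by linarith
    qed
    ultimately have "\<forall>i\<in>I. p dvd u i"
      unfolding \<Psi>_def m_def I_def
      using two_variable_independence[OF p h \<open>finite E\<close>] cardE b(2) by simp
    with u show False by blast
  qed
  moreover have "vanishes_mod p D x \<Psi>" if x: "x \<in> S" for x
  proof (rule vanishes_mod_of_derivatives[OF p _ \<open>int D \<le> p\<close>])
    have unit: "\<not> p dvd y" if "p dvd y ^ t - 1" for y
    proof
      assume "p dvd y"
      then have "p dvd y ^ t" using \<open>0 < t\<close> by (meson dvd_power_le dvd_refl dvd_trans dvd_power)
      with that have "p dvd 1"
        by (metis diff_diff_eq2 add_diff_cancel_left' dvd_diff)
      with p show False by (simp add: not_prime_unit)
    qed
    show "\<not> p dvd poly w x"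
      using unit[OF root(1)[OF x]] unit[OF root(2)[OF x]] p
      by (auto simp: w_def prime_dvd_mult_iff add.commute simp del: mult_pCons_left)
    fix k assume k: "k < D"
    define Q where "Q = (\<Sum>i\<in>I. smult (u i) (R k i))"
    have m_der: "(derive_along w ^^ k) (m i) = G i * R k i" for i
    proof -
      have "m i = G i * [:0, 1:] ^ (snd i mod t)"
        by (simp add: m_def G_def mult_ac flip: power_add)
      moreover have "derive_along w (G i) = v i * G i"
        unfolding w_def G_def v_def by (rule derive_along_powers)
      ultimately show ?thesis
        unfolding R_def by (simp only: funpow_derive_along_conj)
    qed
    have "[:p:] dvd Q"
      unfolding const_poly_dvd_iff
    proof
      fix n
      show "p dvd coeff Q n"
      proof (cases "n < A + D")
        case True
        then have "p dvd (\<Sum>i\<in>I. u i * coeff (R k i) n)"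
          using ker k by (auto simp: J_def)
        then show ?thesis
          by (simp add: Q_def coeff_sum)
      next
        case False
        have "degree (R k i) < A + D" if "i \<in> I" for i
        proof -
          have "degree (R k i) \<le> degree ([:0, 1:] ^ (snd i mod t) :: int poly) + k"
            unfolding R_def
            by (rule degree_funpow_twisted) (auto simp: v_def w_def)
          also have "\<dots> < A + D"
            using that k by (auto simp: degree_power_eq I_def E_def intro: add_strict_mono)
          finally show ?thesis .
        qed
        with False have "coeff (R k i) n = 0" if "i \<in> I" for i
          using that by (meson coeff_eq_0 less_le_trans not_less)
        then show ?thesis
          by (simp add: Q_def coeff_sum)
      qed
    qed
    have cong: "[poly (G i) x = 1] (mod p)" for i
    proof -
      have "[x ^ t = 1] (mod p)" "[(x + h) ^ t = 1] (mod p)"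
        using root[OF x] by (auto simp: cong_iff_dvd_diff)
      then have "[(x ^ t) ^ (snd i div t) * ((x + h) ^ t) ^ fst i = 1 ^ (snd i div t) * 1 ^ fst i] (mod p)"
        by (intro cong_mult cong_pow)
      then show ?thesis
        by (simp add: G_def power_mult add.commute)
    qed
    have "poly ((derive_along w ^^ k) \<Psi>) x = (\<Sum>i\<in>I. u i * (poly (G i) x * poly (R k i) x))"
      by (simp add: \<Psi>_def funpow_derive_along_sum m_der poly_sum)
    also have "[\<dots> = (\<Sum>i\<in>I. u i * (1 * poly (R k i) x))] (mod p)"
      by (intro cong_sum cong_mult cong_refl cong)
    also have "(\<Sum>i\<in>I. u i * (1 * poly (R k i) x)) = poly Q x"
      by (simp add: Q_def poly_sum)
    finally show "p dvd poly ((derive_along w ^^ k) \<Psi>) x"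
      using const_dvd_imp_dvd_poly[OF \<open>[:p:] dvd Q\<close>] by (simp add: cong_dvd_iff)
  qed
  ultimately have "D * card S \<le> degree \<Psi>"
    using zeros_mod_le_degree[OF p S(1)] S(2) by blast
  also have "degree \<Psi> \<le> 2 * (t * B)"
    unfolding \<Psi>_def
  proof (rule degree_sum_smult_le)
    fix i assume "i \<in> I"
    then have "fst i \<le> B" "snd i \<le> t * B"
      by (auto simp: I_def E_def)
    then have "snd i + t * fst i \<le> 2 * (t * B)"
      using mult_le_mono2[of "fst i" B t] by linarith
    moreover have "degree (m i) \<le> snd i + t * fst i"
      unfolding m_def by (rule order_trans[OF degree_mult_le]) (simp add: degree_power_eq)
    ultimately show "degree (m i) \<le> 2 * (t * B)" by linarith
  qed
  finally have "(2 * b) * (b * card S) \<le> (2 * b) * (2 * t)"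
    by (simp add: D_def B_def power2_eq_square mult_ac)
  then show ?thesis
    using b(1) by simp
qed

section \<open>Roots of a squarefree polynomial modulo n\<close>

definition roots_mod :: "int poly \<Rightarrow> nat \<Rightarrow> int set" where
  "roots_mod f n = {x. 0 \<le> x \<and> x < int n \<and> int n dvd poly f x}"

lemma finite_roots_mod: "finite (roots_mod f n)"
  by (rule finite_subset[of _ "{0..<int n}"]) (auto simp: roots_mod_def)

lemma dvd_poly_mod_iff: "n dvd poly f (x mod n) \<longleftrightarrow> n dvd poly f x" for n x :: int
proof -
  obtain g where g: "f = [:- x, 1:] * g + [:poly f x:]"
    using split_off_root[of f x] by blast
  have "poly f (x mod n) - poly f x = (x mod n - x) * poly g (x mod n)"
    using arg_cong[OF g, of "\<lambda>q. poly q (x mod n)"] by (simp add: algebra_simps)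
  moreover have "n dvd x mod n - x"
    by (simp flip: mod_eq_dvd_iff)
  ultimately have "[poly f (x mod n) = poly f x] (mod n)"
    by (simp add: cong_iff_dvd_diff)
  then show ?thesis by (rule cong_dvd_iff)
qed

text \<open>
  Chinese remainder theorem; only the injectivity of the reduction map enters.
\<close>

lemma card_roots_mod_mult_le:
  assumes "coprime m n"
  shows "card (roots_mod f (m * n)) \<le> card (roots_mod f m) * card (roots_mod f n)"
proof -
  let ?g = "\<lambda>x. (x mod int m, x mod int n)"
  have "inj_on ?g (roots_mod f (m * n))"
  proof (rule inj_onI)
    fix x y assume xy: "x \<in> roots_mod f (m * n)" "y \<in> roots_mod f (m * n)" "?g x = ?g y"
    then have "[x = y] (mod int m)" "[x = y] (mod int n)"
      by (auto simp: cong_def)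
    then have "[x = y] (mod int (m * n))"
      using assms by (auto intro: coprime_cong_mult)
    then show "x = y"
      using xy by (auto simp: roots_mod_def intro: cong_less_imp_eq_int)
  qed
  moreover have "?g ` roots_mod f (m * n) \<subseteq> roots_mod f m \<times> roots_mod f n"
  proof -
    have "?g x \<in> roots_mod f m \<times> roots_mod f n" if "x \<in> roots_mod f (m * n)" for x
    proof -
      have "int (m * n) > 0" "int m dvd poly f x" "int n dvd poly f x"
        using that by (auto simp: roots_mod_def elim: dvd_mult_left dvd_mult_right)
      then show ?thesis
        by (auto simp: roots_mod_def dvd_poly_mod_iff zero_less_mult_iff)
    qed
    then show ?thesis by blast
  qed
  ultimately have "card (roots_mod f (m * n)) \<le> card (roots_mod f m \<times> roots_mod f n)"
    by (intro card_inj_on_le) (auto simp: finite_roots_mod)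
  then show ?thesis
    by (simp add: card_cartesian_product)
qed

lemma poly_taylor2:
  fixes f :: "'a :: idom poly"
  shows "\<exists>s. poly f y = poly f x + (y - x) * poly (pderiv f) x + (y - x)^2 * s"
proof (induction f)
  case (pCons a f)
  then obtain s where s: "poly f y = poly f x + (y - x) * poly (pderiv f) x + (y - x)^2 * s"
    by blast
  have "poly (pCons a f) y = poly (pCons a f) x + (y - x) * poly (pderiv (pCons a f)) x
      + (y - x)^2 * (poly (pderiv f) x + y * s)"
    by (simp add: s pderiv_pCons power2_eq_square algebra_simps)
  then show ?case ..
qed simp

text \<open>
  Multiply the second order Taylor expansion of \<open>f y - f x\<close> by \<open>h x\<close>, where \<open>h x * f' x = R\<close> up to
  a multiple of \<open>f x\<close>. This takes the place of Hensel's lemma: if a prime dividing \<open>y - x\<close> does not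
  divide \<open>R\<close>, it does not divide the second factor either, so that a whole power of it
  dividing the product divides \<open>y - x\<close>.
\<close>

lemma root_difference_dvd:
  fixes f g h :: "int poly" and n R x y :: int
  assumes bezout: "g * f + h * pderiv f = [:R:]"
    and "n dvd poly f x" "n dvd poly f y"
  shows "\<exists>s. n dvd (y - x) * (R + (y - x) * s)"
proof -
  obtain s where s: "poly f y = poly f x + (y - x) * poly (pderiv f) x + (y - x)^2 * s"
    using poly_taylor2 by blast
  have R: "poly g x * poly f x + poly h x * poly (pderiv f) x = R"
    using arg_cong[OF bezout, of "\<lambda>q. poly q x"] by simp
  have "(y - x) * (R + (y - x) * (s * poly h x))
      = poly h x * (poly f y - poly f x) + (y - x) * poly g x * poly f x"
    unfolding R[symmetric] s by (simp add: power2_eq_square algebra_simps)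
  moreover have "n dvd \<dots>"
    using assms(2,3) by (intro dvd_add dvd_mult dvd_diff)
  ultimately show ?thesis by metis
qed

text \<open>
  Roots modulo \<open>q ^ k\<close> that are congruent modulo \<open>q\<close> are equal, because the second factor in
  \<open>root_difference_dvd\<close> is then coprime to \<open>q\<close>. So there are no more of them than roots modulo \<open>q\<close>;
  the value \<open>1\<close> covers \<open>k = 0\<close>.
\<close>

lemma card_roots_mod_prime_power_regular:
  fixes f g h :: "int poly"
  assumes bezout: "g * f + h * pderiv f = [:R:]" and q: "prime q" and "\<not> int q dvd R"
  shows "card (roots_mod f (q ^ k)) \<le> max 1 (degree f)"
proof (cases "k = 0")
  case True
  then have "roots_mod f (q ^ k) \<subseteq> {0}"
    by (auto simp: roots_mod_def)
  then have "card (roots_mod f (q ^ k)) \<le> card {0 :: int}"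
    by (intro card_mono) auto
  then show ?thesis by simp
next
  case False
  have q': "prime (int q)" using q by simp
  have "1 * card (roots_mod f (q ^ k)) \<le> degree f"
  proof (rule zeros_mod_le_degree[OF q' finite_roots_mod])
    show "\<not> [:int q:] dvd f"
    proof
      assume "[:int q:] dvd f"
      moreover from this have "[:int q:] dvd pderiv f"
        using funpow_derive_along_const_dvd[where w = 1 and k = 1] by (simp add: derive_along_def)
      ultimately have "[:int q:] dvd [:R:]"
        unfolding bezout[symmetric] by (intro dvd_add dvd_mult)
      with assms(3) show False by simp
    qed
    fix x assume x: "x \<in> roots_mod f (q ^ k)"
    have "int q dvd int (q ^ k)" using False by simp
    then show "vanishes_mod (int q) 1 x f"
      using x by (intro vanishes_mod_1) (auto simp: roots_mod_def intro: dvd_trans)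
    fix y assume y: "y \<in> roots_mod f (q ^ k)" and "x \<noteq> y"
    show "\<not> int q dvd x - y"
    proof
      assume xy: "int q dvd x - y"
      obtain s where s: "int (q ^ k) dvd (x - y) * (R + (x - y) * s)"
        using root_difference_dvd[OF bezout, of "int (q ^ k)" y x] x y by (auto simp: roots_mod_def)
      have "\<not> int q dvd R + (x - y) * s"
        using xy assms(3) by (simp add: dvd_add_left_iff)
      then have "coprime (int (q ^ k)) (R + (x - y) * s)"
        using q' by (simp add: prime_imp_coprime)
      then have "int (q ^ k) dvd x - y"
        using s by (simp add: coprime_dvd_mult_left_iff)
      then have "[x = y] (mod int (q ^ k))"
        by (simp add: cong_iff_dvd_diff)
      then have "x = y"
        using x y by (auto simp: roots_mod_def intro: cong_less_imp_eq_int)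
      with \<open>x \<noteq> y\<close> show False ..
    qed
  qed
  then show ?thesis by simp
qed

text \<open>
  For the finitely many primes dividing \<open>R\<close> only a bound independent of \<open>k\<close> matters. If
  \<open>y - x = q R m\<close>, the second factor in \<open>root_difference_dvd\<close> is \<open>R (1 + q m s)\<close>, so that
  \<open>R (y - x)\<close> is a multiple of \<open>q ^ k\<close>. Hence a root is determined by its residue
  modulo \<open>q R\<close> together with the quotient of \<open>R x\<close> by \<open>q ^ k\<close>.
\<close>

lemma card_roots_mod_prime_power_singular:
  fixes f g h :: "int poly"
  assumes bezout: "g * f + h * pderiv f = [:int R:]" and "R > 0" and q: "prime q" and "q dvd R"
  shows "card (roots_mod f (q ^ k)) \<le> R ^ 3"
proof -
  let ?n = "int (q ^ k)"
  let ?\<phi> = "\<lambda>x. (x mod int (q * R), int R * x div ?n)"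
  have n: "?n > 0" using q by (simp add: prime_gt_0_nat)
  have "inj_on ?\<phi> (roots_mod f (q ^ k))"
  proof (rule inj_onI)
    fix x y assume xy: "x \<in> roots_mod f (q ^ k)" "y \<in> roots_mod f (q ^ k)" "?\<phi> x = ?\<phi> y"
    obtain s where s: "?n dvd (y - x) * (int R + (y - x) * s)"
      using root_difference_dvd[OF bezout, of ?n x y] xy by (auto simp: roots_mod_def)
    have "int (q * R) dvd y - x"
      using xy(3) by (auto simp: mod_eq_dvd_iff[symmetric])
    then obtain m where m: "y - x = int (q * R) * m" ..
    have "(y - x) * (int R + (y - x) * s) = (int R * (y - x)) * (1 + int q * (m * s))"
      unfolding m by (simp add: algebra_simps)
    then have "?n dvd (int R * (y - x)) * (1 + int q * (m * s))"
      using s by (simp only:)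
    moreover have "coprime ?n (1 + int q * (m * s))"
    proof -
      have "coprime (int q) (1 + int q * (m * s))"
        by (metis add.commute coprime_1_right gcd_add_mult coprime_iff_gcd_eq_1 mult.commute)
      then show ?thesis by simp
    qed
    ultimately have "?n dvd int R * (y - x)"
      by (simp add: coprime_dvd_mult_left_iff)
    then have "int R * y mod ?n = int R * x mod ?n"
      by (simp add: mod_eq_dvd_iff right_diff_distrib)
    moreover have "int R * y div ?n = int R * x div ?n"
      using xy(3) by simp
    ultimately have "int R * y = int R * x"
      by (metis div_mult_mod_eq)
    then show "x = y"
      using \<open>R > 0\<close> by simp
  qed
  moreover have "?\<phi> ` roots_mod f (q ^ k) \<subseteq> {0..<int (q * R)} \<times> {0..<int R}"
  proof -
    have "?\<phi> x \<in> {0..<int (q * R)} \<times> {0..<int R}" if "x \<in> roots_mod f (q ^ k)" for x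
    proof -
      have "0 \<le> x" "x < ?n" using that by (auto simp: roots_mod_def)
      then have "int R * x < int R * ?n"
        using \<open>R > 0\<close> by simp
      moreover have "int R * ?n \<le> (int R * x div ?n) * ?n" if "int R \<le> int R * x div ?n"
        using that n by (intro mult_right_mono) auto
      moreover have "(int R * x div ?n) * ?n \<le> int R * x"
        using pos_mod_sign[OF n, of "int R * x"] div_mult_mod_eq[of "int R * x" ?n] by linarith
      ultimately have "int R * x div ?n < int R"
        by linarith
      moreover have "0 \<le> int R * x div ?n"
        using \<open>0 \<le> x\<close> n by (simp add: pos_imp_zdiv_nonneg_iff)
      moreover have "int (q * R) > 0"
        using q \<open>R > 0\<close> by (simp add: prime_gt_0_nat)
      ultimately show ?thesis
        by (simp add: pos_mod_bound pos_mod_sign)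
    qed
    then show ?thesis by blast
  qed
  ultimately have "card (roots_mod f (q ^ k)) \<le> card ({0..<int (q * R)} \<times> {0..<int R})"
    by (intro card_inj_on_le) auto
  also have "\<dots> = q * R * R"
    by (simp add: card_cartesian_product flip: of_nat_mult)
  also have "\<dots> \<le> R * R * R"
    using assms(2,4) by (simp add: dvd_imp_le)
  finally show ?thesis
    by (simp add: power3_eq_cube)
qed

text \<open>
  A nonzero element \<open>m\<close> of least degree in the ideal generated by \<open>f\<close> and \<open>f'\<close> divides, by
  pseudo-division, a constant multiple of each element of the ideal. A prime factor of \<open>m\<close> of
  positive degree does not divide constants, so it would be a common factor of \<open>f\<close> and \<open>f'\<close>; hence
  \<open>m\<close> is constant. The primitive part of \<open>m\<close> has only prime factors of positive degree.
\<close>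

lemma const_multiple_in_poly_ideal:
  fixes f :: "int poly"
  assumes f: "f \<noteq> 0"
    and no_common: "\<And>q. prime_elem q \<Longrightarrow> degree q > 0 \<Longrightarrow> q dvd f \<Longrightarrow> \<not> q dvd f'"
  shows "\<exists>g h R. R > 0 \<and> g * f + h * f' = [:int R:]"
proof -
  define ideal where "ideal = {m. m \<noteq> 0 \<and> (\<exists>g h. m = g * f + h * f')}"
  have "f \<in> ideal"
  proof -
    have "f = 1 * f + 0 * f'" by simp
    then show ?thesis using f unfolding ideal_def by blast
  qed
  then obtain m where m: "m \<in> ideal" and min: "\<And>r. r \<in> ideal \<Longrightarrow> degree m \<le> degree r"
    using ex_has_least_nat[of "\<lambda>r. r \<in> ideal" f degree] by blast
  obtain g h where gh: "m = g * f + h * f'" and "m \<noteq> 0"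
    using m by (auto simp: ideal_def)
  have dvd: "\<exists>c. c \<noteq> 0 \<and> m dvd smult c r" if r: "\<exists>g h. r = g * f + h * f'" for r
  proof -
    obtain q s where qs: "pseudo_divmod r m = (q, s)" by fastforce
    define c where "c = lead_coeff m ^ (Suc (degree r) - degree m)"
    have eq: "smult c r = m * q + s" and s: "s = 0 \<or> degree s < degree m"
      using pseudo_divmod[OF \<open>m \<noteq> 0\<close> qs] by (auto simp: c_def)
    obtain g1 h1 where "r = g1 * f + h1 * f'" using r by blast
    then have "s = smult c (g1 * f + h1 * f') - (g * f + h * f') * q"
      using eq gh by (simp add: algebra_simps)
    then have "s = (smult c g1 - g * q) * f + (smult c h1 - h * q) * f'"
      by (simp add: algebra_simps smult_add_right)
    then have "s = 0"
      using s min[of s] unfolding ideal_def by fastforce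
    with eq have "m dvd smult c r" by simp
    moreover have "c \<noteq> 0" using \<open>m \<noteq> 0\<close> by (simp add: c_def)
    ultimately show ?thesis by blast
  qed
  have "degree m = 0"
  proof (rule ccontr)
    assume deg: "degree m \<noteq> 0"
    have "primitive_part m \<noteq> 0" "\<not> is_unit (primitive_part m)"
      using deg \<open>m \<noteq> 0\<close> by (auto simp: is_unit_poly_iff dest!: arg_cong[of _ _ degree])
    then obtain q where q: "prime q" "q dvd primitive_part m"
      using prime_divisor_exists by blast
    have qm: "q dvd m"
      using q(2) by (metis content_times_primitive_part dvd_smult)
    have degq: "degree q > 0"
    proof (rule ccontr)
      assume "\<not> degree q > 0"
      then obtain c where c: "q = [:c:]" by (auto elim: degree_eq_zeroE)
      then have "c dvd content (primitive_part m)"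
        using q(2) by (simp add: const_poly_dvd_iff_dvd_content)
      then have "is_unit q"
        using \<open>m \<noteq> 0\<close> c by (simp add: is_unit_const_poly_iff)
      with q(1) show False by (simp add: not_prime_unit)
    qed
    have "q dvd r" if r: "\<exists>g h. r = g * f + h * f'" for r
    proof -
      obtain c where c: "c \<noteq> 0" "m dvd smult c r" using dvd[OF r] by blast
      have "q dvd [:c:] * r" using dvd_trans[OF qm c(2)] by simp
      moreover have "\<not> q dvd [:c:]"
        using c(1) degq dvd_imp_degree_le[of q "[:c:]"] by auto
      ultimately show ?thesis
        using q(1) prime_dvd_mult_iff by blast
    qed
    then have "q dvd 1 * f + 0 * f'" "q dvd 0 * f + 1 * f'" by blast+
    then show False
      using no_common[of q] q(1) degq by (simp add: prime_imp_prime_elem)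
  qed
  then obtain R where R: "m = [:R:]" by (rule degree_eq_zeroE)
  have "R \<noteq> 0" using R \<open>m \<noteq> 0\<close> by auto
  show ?thesis
  proof (cases "R > 0")
    case True
    then show ?thesis
      using gh R by (intro exI[of _ g] exI[of _ h] exI[of _ "nat R"]) simp
  next
    case False
    have "(- g) * f + (- h) * f' = - m"
      unfolding gh by (simp add: algebra_simps)
    with False have "(- g) * f + (- h) * f' = [:int (nat (- R)):]"
      by (simp add: R)
    with False \<open>R \<noteq> 0\<close> show ?thesis
      by (intro exI[of _ "- g"] exI[of _ "- h"] exI[of _ "nat (- R)"]) simp
  qed
qed

text \<open>
  A common prime factor \<open>q\<close> of \<open>f = q r\<close> and \<open>f' = q' r + q r'\<close> divides \<open>q' r\<close>, hence \<open>r\<close>, because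
  \<open>q'\<close> is nonzero of smaller degree; so \<open>q\<^sup>2\<close> divides \<open>f\<close>.
\<close>

lemma squarefree_poly_bezout:
  assumes "squarefree_poly f"
  shows "\<exists>g h R. R > 0 \<and> g * f + h * pderiv f = [:int R:]"
proof (rule const_multiple_in_poly_ideal)
  show "f \<noteq> 0" using assms by (rule squarefree_poly_nonzero)
  fix q :: "int poly"
  assume q: "prime_elem q" "degree q > 0" "q dvd f"
  show "\<not> q dvd pderiv f"
  proof
    assume "q dvd pderiv f"
    obtain r where r: "f = q * r" using q(3) ..
    have "q dvd r * pderiv q"
      using \<open>q dvd pderiv f\<close> unfolding r pderiv_mult
      by (simp add: dvd_add_right_iff)
    moreover have "\<not> q dvd pderiv q"
    proof
      assume "q dvd pderiv q"
      moreover have "pderiv q \<noteq> 0" using q(2) by (simp add: pderiv_eq_0_iff)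
      ultimately have "degree q \<le> degree (pderiv q)" by (rule dvd_imp_degree_le)
      with q(2) show False by (simp add: degree_pderiv)
    qed
    ultimately have "q dvd r"
      using q(1) prime_elem_dvd_mult_iff by blast
    then have "q ^ 2 dvd f"
      unfolding r power2_eq_square by (rule mult_dvd_mono[OF dvd_refl])
    with assms q(2) show False
      by (auto simp: squarefree_poly_def)
  qed
qed

lemma card_roots_mod_prime_power_bounded:
  assumes "squarefree_poly f"
  shows "\<exists>K. \<forall>q k. prime q \<longrightarrow> card (roots_mod f (q ^ k)) \<le> K"
proof -
  obtain g h R where R: "R > 0" "g * f + h * pderiv f = [:int R:]"
    using squarefree_poly_bezout[OF assms] by blast
  have "card (roots_mod f (q ^ k)) \<le> max (max 1 (degree f)) (R ^ 3)" if "prime q" for q k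
    using card_roots_mod_prime_power_regular[OF R(2) that, of k]
      card_roots_mod_prime_power_singular[OF R(2,1) that, of k]
    by (cases "q dvd R") (auto simp: le_max_iff_disj)
  then show ?thesis by blast
qed

section \<open>Growth of submultiplicative functions\<close>

text \<open>
  The proof of the divisor bound. Take \<open>K \<ge> 1\<close>. For primes \<open>q\<close> with \<open>q powr \<epsilon> \<ge> 2 K\<close>
  and \<open>k \<ge> 1\<close> one has \<open>K (k + 1) \<le> (2 K) ^ k \<le> (q ^ k) powr \<epsilon>\<close>, so they contribute no constant; each of the finitely
  many smaller primes contributes a bounded factor \<open>M\<close>, because \<open>k + 1\<close> is at most a constant times
  \<open>(2 ^ k) powr \<epsilon>\<close>.
\<close>

lemma submultiplicative_growth:
  fixes g :: "nat \<Rightarrow> real" and K \<epsilon> :: real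
  assumes nonneg: "\<And>n. 0 \<le> g n" and one: "g 1 \<le> 1"
    and mult: "\<And>m n. coprime m n \<Longrightarrow> g (m * n) \<le> g m * g n"
    and prime_power: "\<And>q k. prime q \<Longrightarrow> g (q ^ k) \<le> K * (real k + 1)"
    and "\<epsilon> > 0"
  shows "\<exists>C>0. \<forall>n>0. g n \<le> C * real n powr \<epsilon>"
proof -
  define L where "L = max K 1"
  define Q where "Q = nat \<lceil>(2 * L) powr (1 / \<epsilon>)\<rceil>"
  define M where "M = L * max 1 (1 / (\<epsilon> * ln 2))"
  define small where "small n = {q \<in> prime_factors n. q < Q}" for n
  have L: "K \<le> L" "1 \<le> L" by (auto simp: L_def)
  have M: "1 \<le> M"
    unfolding M_def using L mult_mono[of 1 L 1 "max 1 (1 / (\<epsilon> * ln 2))"] by simp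
  have le_M: "g (q ^ k) \<le> M * real (q ^ k) powr \<epsilon>" if q: "prime q" for q k
  proof -
    have "1 + real k * (\<epsilon> * ln 2) \<le> exp (real k * (\<epsilon> * ln 2))"
      by (rule exp_ge_add_one_self)
    also have "\<dots> = real (2 ^ k) powr \<epsilon>"
      by (simp add: powr_def ln_realpow mult_ac)
    also have "\<dots> \<le> real (q ^ k) powr \<epsilon>"
      using q \<open>\<epsilon> > 0\<close> by (intro powr_mono2) (auto simp: prime_ge_2_nat power_mono)
    finally have *: "1 + real k * (\<epsilon> * ln 2) \<le> real (q ^ k) powr \<epsilon>" .
    have "real k + 1 \<le> max 1 (1 / (\<epsilon> * ln 2)) * (1 + real k * (\<epsilon> * ln 2))"
    proof -
      have "1 \<le> max 1 (1 / (\<epsilon> * ln 2)) * (\<epsilon> * ln 2)"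
        using \<open>\<epsilon> > 0\<close> mult_right_mono[of "1 / (\<epsilon> * ln 2)" "max 1 (1 / (\<epsilon> * ln 2))" "\<epsilon> * ln 2"] by simp
      then have "real k * 1 \<le> real k * (max 1 (1 / (\<epsilon> * ln 2)) * (\<epsilon> * ln 2))"
        by (rule mult_left_mono) simp
      moreover have "1 \<le> max 1 (1 / (\<epsilon> * ln 2))" by simp
      ultimately show ?thesis
        by (simp only: distrib_left mult_1_right mult_ac)
    qed
    also have "\<dots> \<le> max 1 (1 / (\<epsilon> * ln 2)) * real (q ^ k) powr \<epsilon>"
      using * by (intro mult_left_mono) auto
    finally have "L * (real k + 1) \<le> M * real (q ^ k) powr \<epsilon>"
      using L unfolding M_def mult.assoc by (intro mult_left_mono) auto
    moreover have "g (q ^ k) \<le> L * (real k + 1)"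
      using prime_power[OF q, of k] L mult_right_mono[of K L "real k + 1"] by linarith
    ultimately show ?thesis by linarith
  qed
  have le_1: "g (q ^ k) \<le> real (q ^ k) powr \<epsilon>" if q: "prime q" "Q \<le> q" "k > 0" for q k
  proof -
    have "(2 * L) powr (1 / \<epsilon>) \<le> real q"
      using q(2) unfolding Q_def by linarith
    then have "((2 * L) powr (1 / \<epsilon>)) powr \<epsilon> \<le> real q powr \<epsilon>"
      using \<open>\<epsilon> > 0\<close> by (intro powr_mono2) auto
    then have base: "2 * L \<le> real q powr \<epsilon>"
      using L \<open>\<epsilon> > 0\<close> by (simp add: powr_powr)
    have "g (q ^ k) \<le> L * (real k + 1)"
      using prime_power[OF q(1), of k] L mult_right_mono[of K L "real k + 1"] by linarith
    also have "\<dots> \<le> L ^ k * 2 ^ k"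
    proof (rule mult_mono)
      show "L \<le> L ^ k" using L q(3) by (simp add: self_le_power)
      have "Suc k \<le> 2 ^ k" by (rule Suc_leI) (rule less_exp)
      then have "real (Suc k) \<le> real (2 ^ k)" by (rule of_nat_mono)
      then show "real k + 1 \<le> 2 ^ k" by (simp add: add.commute)
    qed (use L in auto)
    also have "\<dots> = (2 * L) ^ k"
      by (simp add: power_mult_distrib)
    also have "\<dots> \<le> (real q powr \<epsilon>) ^ k"
      using base L by (intro power_mono) auto
    also have "\<dots> = real (q ^ k) powr \<epsilon>"
      using q(1) by (simp add: powr_power prime_gt_0_nat flip: powr_realpow) (simp add: powr_powr mult.commute)
    finally show ?thesis .
  qed
  have fin: "finite (small n)" for n by (simp add: small_def)
  have bound: "g n \<le> M ^ card (small n) * real n powr \<epsilon>" if "n > 0" for n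
    using that
  proof (induction n rule: less_induct)
    case (less n)
    show ?case
    proof (cases "n = 1")
      case True
      then show ?thesis using one by (simp add: small_def)
    next
      case False
      then obtain q where q: "prime q" "q dvd n"
        using prime_factor_nat by blast
      define k where "k = multiplicity q n"
      obtain m where m: "n = q ^ k * m" "\<not> q dvd m"
        using multiplicity_decompose'[of n q] less.prems q(1) unfolding k_def
        by (metis not_prime_unit not_gr0)
      have "k > 0"
        using q m by (metis gr0I mult_1 power_0)
      have "m > 0" using m(1) less.prems by (metis gr0I mult_0_right)
      have "1 < q ^ k"
        using \<open>k > 0\<close> q(1) by (intro one_less_power prime_gt_1_nat)
      then have "m < n" using m(1) \<open>m > 0\<close> by simp
      have "coprime (q ^ k) m"
        using q(1) m(2) by (simp add: prime_imp_coprime)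
      have pf: "prime_factors n = insert q (prime_factors m)"
        using m(1) q(1) \<open>k > 0\<close> \<open>m > 0\<close>
        by (simp add: prime_factors_product prime_factorization_prime_power prime_gt_0_nat)
      have "q \<notin> prime_factors m" using m(2) by auto
      have step: "g (q ^ k) * M ^ card (small m) \<le> M ^ card (small n) * real (q ^ k) powr \<epsilon>"
      proof (cases "q < Q")
        case True
        then have "small n = insert q (small m)" "q \<notin> small m"
          using pf \<open>q \<notin> prime_factors m\<close> by (auto simp: small_def)
        then have "card (small n) = Suc (card (small m))"
          by (simp add: fin)
        then show ?thesis
          using mult_right_mono[OF le_M[OF q(1), of k], of "M ^ card (small m)"] M
          by (simp add: mult_ac)
      next
        case False
        then have "small n = small m"
          using pf by (auto simp: small_def)
        then show ?thesis
          using mult_right_mono[OF le_1[OF q(1) _ \<open>k > 0\<close>], of "M ^ card (small m)"] M False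
          by (simp add: mult_ac)
      qed
      have "g n \<le> g (q ^ k) * g m"
        unfolding m(1) by (rule mult) fact
      also have "\<dots> \<le> g (q ^ k) * (M ^ card (small m) * real m powr \<epsilon>)"
        using less.IH[OF \<open>m < n\<close> \<open>m > 0\<close>] nonneg by (intro mult_left_mono) auto
      also have "\<dots> = g (q ^ k) * M ^ card (small m) * real m powr \<epsilon>"
        by simp
      also have "\<dots> \<le> M ^ card (small n) * real (q ^ k) powr \<epsilon> * real m powr \<epsilon>"
        by (rule mult_right_mono[OF step]) simp
      also have "\<dots> = M ^ card (small n) * real n powr \<epsilon>"
        unfolding m(1) of_nat_mult by (subst powr_mult) auto
      finally show ?thesis .
    qed
  qed
  have "g n \<le> M ^ Q * real n powr \<epsilon>" if "n > 0" for n
  proof -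
    have "card (small n) \<le> card {..<Q}"
      by (intro card_mono) (auto simp: small_def)
    then have "M ^ card (small n) \<le> M ^ Q"
      using M by (intro power_increasing) auto
    then have "M ^ card (small n) * real n powr \<epsilon> \<le> M ^ Q * real n powr \<epsilon>"
      by (intro mult_right_mono) auto
    with bound[OF that] show ?thesis by linarith
  qed
  moreover have "0 < M ^ Q" using M by simp
  ultimately show ?thesis by blast
qed

lemma card_divisors_growth:
  assumes "\<epsilon> > 0"
  shows "\<exists>C>0. \<forall>n>0. real (card {d. d dvd n}) \<le> C * real n powr \<epsilon>"
proof (rule submultiplicative_growth[where K = 1])
  fix m n :: nat
  have "card {d. d dvd m * n} \<le> card ((\<lambda>(a, b). a * b) ` ({d. d dvd m} \<times> {d. d dvd n}))" if "m > 0" "n > 0"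
  proof (rule card_mono)
    show "{d. d dvd m * n} \<subseteq> (\<lambda>(a, b). a * b) ` ({d. d dvd m} \<times> {d. d dvd n})"
      by (auto elim!: dvd_productE)
    show "finite ((\<lambda>(a, b). a * b) ` ({d. d dvd m} \<times> {d. d dvd n}))"
      using that by simp
  qed
  also have "\<dots> \<le> card ({d. d dvd m} \<times> {d. d dvd n})" if "m > 0" "n > 0"
    using that by (intro card_image_le) auto
  also have "\<dots> = card {d. d dvd m} * card {d. d dvd n}"
    by (rule card_cartesian_product)
  finally have "card {d. d dvd m * n} \<le> card {d. d dvd m} * card {d. d dvd n}" if "m > 0" "n > 0"
    using that by blast
  moreover have "card {d. d dvd m * n} \<le> card {d. d dvd m} * card {d. d dvd n}" if "m = 0 \<or> n = 0"
    using that by (auto simp: infinite_UNIV_nat)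
  ultimately have "card {d. d dvd m * n} \<le> card {d. d dvd m} * card {d. d dvd n}"
    by blast
  then show "real (card {d. d dvd m * n}) \<le> real (card {d. d dvd m}) * real (card {d. d dvd n})"
    by (simp flip: of_nat_mult)
next
  fix q k :: nat
  assume "prime q"
  then have "{d. d dvd q ^ k} = (\<lambda>i. q ^ i) ` {..k}"
    by (auto simp: divides_primepow_nat)
  then have "card {d. d dvd q ^ k} \<le> card {..k}"
    by (metis card_image_le finite_atMost)
  then show "real (card {d. d dvd q ^ k}) \<le> 1 * (real k + 1)"
    by simp
qed (use assms in auto)

section \<open>Subgroup elements in an arithmetic progression\<close>

lemma not_dvd_diff_residues:
  fixes x y p :: int
  assumes "0 \<le> x" "x < p" "0 \<le> y" "y < p" "x \<noteq> y"
  shows "\<not> p dvd x - y"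
  using assms cong_less_imp_eq_int[of x p y] by (auto simp: cong_iff_dvd_diff)

lemma card_power_eq_1_le:
  fixes p :: nat
  assumes p: "prime p" and "d > 0" and A: "A \<subseteq> {1..int p - 1}"
    and root: "\<And>x. x \<in> A \<Longrightarrow> int p dvd x ^ d - 1"
  shows "card A \<le> d"
proof -
  define f :: "int poly" where "f = monom 1 d - 1"
  have "coeff f d = 1"
    using \<open>d > 0\<close> by (simp add: f_def)
  then have nz: "\<not> [:int p:] dvd f"
    using p not_prime_unit[of "int p"] by (auto simp: const_poly_dvd_iff intro!: exI[of _ d])
  have "1 * card A \<le> degree f"
  proof (rule zeros_mod_le_degree[OF _ _ nz])
    show "prime (int p)" using p by simp
    show "finite A" using A finite_subset by blast
    show "\<not> int p dvd x - y" if "x \<in> A" "y \<in> A" "x \<noteq> y" for x y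
      using that A by (intro not_dvd_diff_residues) auto
    show "vanishes_mod (int p) 1 x f" if "x \<in> A" for x
      using root[OF that] by (intro vanishes_mod_1) (simp add: f_def poly_monom)
  qed
  also have "degree f \<le> d"
    unfolding f_def by (intro degree_diff_le) (auto simp: degree_monom_le)
  finally show ?thesis by simp
qed

lemma card_progression_le:
  fixes d n :: nat
  assumes "d > 0" and A: "A \<subseteq> {0..int n}" and cong: "\<And>x. x \<in> A \<Longrightarrow> x mod int d = a"
  shows "card A \<le> n div d + 1"
proof -
  have "inj_on (\<lambda>x. x div int d) A"
    using cong by (intro inj_onI) (metis div_mult_mod_eq)
  moreover have "(\<lambda>x. x div int d) ` A \<subseteq> {0..int (n div d)}"
    using A \<open>d > 0\<close> by (auto simp: zdiv_int pos_imp_zdiv_nonneg_iff zdiv_mono1)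
  ultimately have "card A \<le> card {0..int (n div d)}"
    by (intro card_inj_on_le) auto
  then show ?thesis by simp
qed

text \<open>
  Sort the pairs of elements of \<open>A\<close> by their difference \<open>d * j\<close>. There are at most \<open>2 (p div d)\<close>
  nonzero values of \<open>j\<close>, and each is taken at most \<open>2 d / b\<close> times, by
  \<open>shifted_subgroup_intersection\<close> with the shift \<open>d * j\<close>.
\<close>

lemma subgroup_in_progression:
  fixes p d b :: nat
  assumes p: "prime p" and b: "0 < b" "8 * b ^ 3 \<le> d" "2 * b * d \<le> p"
    and A: "A \<subseteq> {1..int p - 1}"
    and cong: "\<And>x. x \<in> A \<Longrightarrow> x mod int d = a"
    and root: "\<And>x. x \<in> A \<Longrightarrow> int p dvd x ^ d - 1"
  shows "b * (card A)\<^sup>2 \<le> b * card A + 4 * p"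
proof -
  define m where "m = p div d"
  define J where "J = {- int m..int m} - {0}"
  define S where "S j = {x \<in> A. x + int d * j \<in> A}" for j
  have "finite A" using A finite_subset by blast
  have "0 < b ^ 3" using b(1) by simp
  then have "d > 0" using b(2) by linarith
  have S: "b * card (S j) \<le> 2 * d" if "j \<in> J" for j
  proof (cases "S j = {}")
    case False
    then obtain x where x: "x \<in> A" "x + int d * j \<in> A" by (auto simp: S_def)
    have "x + int d * j \<noteq> x" using that \<open>d > 0\<close> by (simp add: J_def)
    then have "\<not> int p dvd (x + int d * j) - x"
      using x A by (intro not_dvd_diff_residues) auto
    then have "\<not> int p dvd int d * j" by simp
    show ?thesis
    proof (rule shifted_subgroup_intersection[OF _ \<open>\<not> int p dvd int d * j\<close> b(1,2)])
      show "prime (int p)" using p by simp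
      show "int (2 * b * d) \<le> int p" using b(3) by (simp only: of_nat_le_iff)
      show "finite (S j)" using \<open>finite A\<close> by (simp add: S_def)
      show "\<not> int p dvd x - y" if "x \<in> S j" "y \<in> S j" "x \<noteq> y" for x y
        using that A by (intro not_dvd_diff_residues) (auto simp: S_def)
    qed (use root in \<open>auto simp: S_def\<close>)
  qed simp
  have "A \<times> A \<subseteq> (\<lambda>x. (x, x)) ` A \<union> (\<Union>j\<in>J. (\<lambda>x. (x, x + int d * j)) ` S j)"
  proof safe
    fix x y assume xy: "x \<in> A" "y \<in> A"
      and "(x, y) \<notin> (\<Union>j\<in>J. (\<lambda>x. (x, x + int d * j)) ` S j)"
    then have no: "j \<notin> J" if "y = x + int d * j" for j
      using that by (auto simp: S_def)
    have "int d dvd y - x"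
      using cong xy by (simp flip: mod_eq_dvd_iff)
    then obtain j where j: "y = x + int d * j"
      by (metis dvdE add_diff_cancel_left' diff_add_cancel add.commute)
    have "\<bar>int d * j\<bar> \<le> int p"
    proof -
      have "x \<in> {1..int p - 1}" "y \<in> {1..int p - 1}" using xy A by blast+
      then show ?thesis using j by auto
    qed
    then have "\<bar>j\<bar> * int d \<le> int p"
      by (simp add: abs_mult mult.commute)
    then have "int (nat \<bar>j\<bar> * d) \<le> int p"
      by simp
    then have "nat \<bar>j\<bar> \<le> m"
      unfolding m_def of_nat_le_iff using \<open>d > 0\<close> by (simp add: less_eq_div_iff_mult_less_eq)
    then have "\<bar>j\<bar> \<le> int m" by linarith
    then have "j = 0" using no[OF j] by (auto simp: J_def)
    then show "(x, y) \<in> (\<lambda>x. (x, x)) ` A" using j xy by simp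
  qed
  then have "card (A \<times> A) \<le> card ((\<lambda>x. (x, x)) ` A \<union> (\<Union>j\<in>J. (\<lambda>x. (x, x + int d * j)) ` S j))"
    using \<open>finite A\<close> by (intro card_mono) (auto simp: J_def S_def)
  also have "\<dots> \<le> card A + (\<Sum>j\<in>J. card (S j))"
  proof (rule order_trans[OF card_Un_le] , rule add_mono)
    show "card ((\<lambda>x. (x, x)) ` A) \<le> card A"
      using \<open>finite A\<close> by (rule card_image_le)
    have "card (\<Union>j\<in>J. (\<lambda>x. (x, x + int d * j)) ` S j) \<le> (\<Sum>j\<in>J. card ((\<lambda>x. (x, x + int d * j)) ` S j))"
      by (rule card_UN_le) (simp add: J_def)
    also have "\<dots> \<le> (\<Sum>j\<in>J. card (S j))"
      using \<open>finite A\<close> by (intro sum_mono card_image_le) (simp add: S_def)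
    finally show "card (\<Union>j\<in>J. (\<lambda>x. (x, x + int d * j)) ` S j) \<le> (\<Sum>j\<in>J. card (S j))" .
  qed
  finally have "b * (card A)\<^sup>2 \<le> b * (card A + (\<Sum>j\<in>J. card (S j)))"
    by (simp add: card_cartesian_product power2_eq_square)
  also have "\<dots> = b * card A + (\<Sum>j\<in>J. b * card (S j))"
    by (simp add: distrib_left sum_distrib_left)
  also have "(\<Sum>j\<in>J. b * card (S j)) \<le> (\<Sum>j\<in>J. 2 * d)"
    by (intro sum_mono S)
  also have "(\<Sum>j\<in>J. 2 * d) = 4 * (m * d)"
    by (simp add: J_def nat_add_distrib nat_mult_distrib)
  also have "m * d \<le> p" by (simp add: m_def)
  finally show ?thesis by simp
qed

text \<open>
  Here \<open>y\<close> is the 13th root of \<open>p\<close>, so that the bound is \<open>3 p powr (6/13)\<close>. Up to \<open>d = y ^ 6\<close> the order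
  of the subgroup suffices, from \<open>d = y ^ 7\<close> on the length of the progression; in between
  \<open>subgroup_in_progression\<close> is applied with \<open>b\<close> of size \<open>y\<close>, and \<open>4 \<le> y\<close> ensures its two
  conditions on \<open>b\<close>.
\<close>

lemma card_class_le:
  fixes p d :: nat and y :: real
  assumes p: "prime p" and y: "y ^ 13 = real p" "4 \<le> y" and d: "d dvd p - 1"
    and A: "A \<subseteq> {1..int p - 1}"
    and cong: "\<And>x. x \<in> A \<Longrightarrow> x mod int d = a"
    and root: "\<And>x. x \<in> A \<Longrightarrow> int p dvd x ^ d - 1"
  shows "real (card A) \<le> 3 * y ^ 6"
proof -
  have "p > 1" using p by (rule prime_gt_1_nat)
  then have "d > 0" using dvd_pos_nat[OF _ d] by simp
  have "d \<le> p - 1" using \<open>p > 1\<close> d by (intro dvd_imp_le) auto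
  consider "real d \<le> y ^ 6" | "y ^ 7 \<le> real d" | "y ^ 6 < real d" "real d < y ^ 7"
    by linarith
  then show ?thesis
  proof cases
    case 1
    have "card A \<le> d" by (rule card_power_eq_1_le[OF p \<open>d > 0\<close> A root])
    then have "real (card A) \<le> y ^ 6" using 1 by linarith
    also have "\<dots> \<le> 3 * y ^ 6" using y(2) by simp
    finally show ?thesis .
  next
    case 2
    have "card A \<le> p div d + 1"
      using A cong by (intro card_progression_le[OF \<open>d > 0\<close>]) auto
    also have "\<dots> \<le> 2 * (p div d)"
    proof -
      have "1 \<le> p div d" using \<open>d > 0\<close> \<open>d \<le> p - 1\<close> by (simp add: Suc_le_eq div_greater_zero_iff)
      then show ?thesis by simp
    qed
    finally have "card A * d \<le> 2 * (p div d * d)"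
      by (metis mult.assoc mult_le_mono1)
    also have "\<dots> \<le> 2 * p" by simp
    finally have "real (card A) * real d \<le> 2 * real p"
      by (metis of_nat_le_iff of_nat_mult of_nat_numeral)
    then have "real (card A) * y ^ 7 \<le> 2 * real p"
      using 2 mult_left_mono[of "y ^ 7" "real d" "real (card A)"] by linarith
    also have "\<dots> = (2 * y ^ 6) * y ^ 7"
      by (simp flip: y(1) power_add)
    finally have "real (card A) \<le> 2 * y ^ 6"
      using y(2) by (subst (asm) mult_le_cancel_right_pos) auto
    also have "\<dots> \<le> 3 * y ^ 6" using y(2) by simp
    finally show ?thesis .
  next
    case 3
    define b where "b = nat \<lceil>y\<rceil>"
    have b: "y \<le> real b" "real b \<le> 2 * y" "0 < b"
      using y(2) unfolding b_def by linarith+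
    have "64 \<le> y ^ 3"
      using power_mono[OF y(2), of 3] by simp
    have "8 * real b ^ 3 \<le> 8 * (2 * y) ^ 3"
      using b by (intro mult_left_mono power_mono) auto
    also have "\<dots> = 64 * y ^ 3" by (simp add: power_mult_distrib)
    also have "\<dots> \<le> y ^ 3 * y ^ 3"
      using \<open>64 \<le> y ^ 3\<close> y(2) by (intro mult_right_mono) auto
    also have "\<dots> = y ^ 6" by (simp flip: power_add)
    finally have "real (8 * b ^ 3) \<le> real d" using 3 by simp
    then have b3: "8 * b ^ 3 \<le> d" by (simp only: of_nat_le_iff)
    have "2 * real b * real d \<le> 2 * (2 * y) * y ^ 7"
      using b 3 by (intro mult_mono) auto
    also have "\<dots> = 4 * y ^ 8" by (simp add: power_numeral_reduce)
    also have "\<dots> \<le> y ^ 5 * y ^ 8"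
    proof (rule mult_right_mono)
      have "4 \<le> y ^ 1" using y(2) by simp
      also have "\<dots> \<le> y ^ 5" using y(2) by (intro power_increasing) auto
      finally show "4 \<le> y ^ 5" .
    qed (use y(2) in auto)
    also have "\<dots> = real p" by (simp flip: y(1) power_add)
    finally have "real (2 * b * d) \<le> real p" by simp
    then have bd: "2 * b * d \<le> p" by (simp only: of_nat_le_iff)
    define n where "n = real (card A)"
    have "b * (card A)\<^sup>2 \<le> b * card A + 4 * p"
      by (rule subgroup_in_progression[OF p b(3) b3 bd A cong root])
    then have "real (b * (card A)\<^sup>2) \<le> real (b * card A + 4 * p)"
      by (simp only: of_nat_le_iff)
    then have "real b * (n\<^sup>2 - n) \<le> 4 * y ^ 13"
      by (simp add: n_def y(1) algebra_simps)
    moreover have "y * (n\<^sup>2 - n) \<le> real b * (n\<^sup>2 - n)"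
    proof (rule mult_right_mono[OF b(1)])
      show "0 \<le> n\<^sup>2 - n"
        by (cases "card A") (auto simp: n_def power2_eq_square)
    qed
    moreover have "4 * y ^ 13 = y * (4 * y ^ 12)"
      by (simp add: power_numeral_reduce)
    ultimately have "y * (n\<^sup>2 - n) \<le> y * (4 * y ^ 12)"
      by linarith
    then have *: "n\<^sup>2 - n \<le> 4 * (y ^ 6)\<^sup>2"
      using y(2) by (simp flip: power_mult)
    have "1 \<le> y ^ 6" using y(2) by (intro one_le_power) simp
    have "n \<le> 3 * y ^ 6"
    proof (rule ccontr)
      assume "\<not> n \<le> 3 * y ^ 6"
      then have "3 * y ^ 6 * (3 * y ^ 6 - 1) < n * (n - 1)"
        using \<open>1 \<le> y ^ 6\<close> by (intro mult_strict_mono) auto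
      also have "\<dots> \<le> 4 * (y ^ 6)\<^sup>2"
        using * by (simp add: power2_eq_square algebra_simps)
      finally have "5 * (y ^ 6 * y ^ 6) < 3 * y ^ 6"
        by (simp add: power2_eq_square algebra_simps)
      moreover have "3 * y ^ 6 \<le> 5 * (y ^ 6 * y ^ 6)"
        using \<open>1 \<le> y ^ 6\<close> mult_left_mono[of 1 "y ^ 6" "y ^ 6"] by linarith
      ultimately show False by linarith
    qed
    then show ?thesis by (simp add: n_def)
  qed
qed

section \<open>Counting the solutions of the congruence\<close>

text \<open>
  Changing the sign of the exponent does not matter for being \<open>1\<close>, and the order of \<open>x\<close>
  divides \<open>p - 1\<close> as well as the exponent.
\<close>

lemma power_eq_1_mod_gcd:
  fixes x k :: int
  assumes p: "prime p" and x: "1 \<le> x" "x \<le> int p - 1"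
    and "[mod_powi p x k = 1] (mod int p)"
  shows "int p dvd x ^ gcd (nat \<bar>k\<bar>) (p - 1) - 1"
proof -
  obtain a where a: "x = int a" using x nonneg_int_cases[of x] by auto
  have "\<not> p dvd a" using x a by (auto dest!: dvd_imp_le)
  then have cop: "coprime p a" using p by (simp add: prime_imp_coprime)
  have "[x ^ nat \<bar>k\<bar> = 1] (mod int p)"
  proof (cases "k \<ge> 0")
    case True
    then show ?thesis using assms(4) by (simp add: mod_powi_def)
  next
    case False
    let ?y = "modular_inverse (int p) x"
    have "[x * ?y = 1] (mod int p)"
      using cop by (intro cong_modular_inverse1) (simp add: a coprime_commute)
    then have "[(x * ?y) ^ nat \<bar>k\<bar> = 1 ^ nat \<bar>k\<bar>] (mod int p)"
      by (rule cong_pow)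
    then have "[x ^ nat \<bar>k\<bar> * ?y ^ nat \<bar>k\<bar> = 1] (mod int p)"
      by (simp add: power_mult_distrib)
    moreover have "[?y ^ nat \<bar>k\<bar> = 1] (mod int p)"
      using assms(4) False by (simp add: mod_powi_def)
    then have "[x ^ nat \<bar>k\<bar> * ?y ^ nat \<bar>k\<bar> = x ^ nat \<bar>k\<bar> * 1] (mod int p)"
      by (intro cong_mult cong_refl)
    ultimately show ?thesis
      by (metis cong_sym cong_trans mult_1_right)
  qed
  then have "[a ^ nat \<bar>k\<bar> = 1] (mod p)"
    unfolding a by (simp flip: cong_int_iff)
  moreover have "[a ^ (p - 1) = 1] (mod p)"
    using p \<open>\<not> p dvd a\<close> by (rule fermat_theorem)
  ultimately have "ord p a dvd gcd (nat \<bar>k\<bar>) (p - 1)"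
    by (metis gcd_greatest ord_divides)
  then have "[a ^ gcd (nat \<bar>k\<bar>) (p - 1) = 1] (mod p)"
    by (simp only: ord_divides)
  then have "[x ^ gcd (nat \<bar>k\<bar>) (p - 1) = 1] (mod int p)"
    unfolding a by (simp flip: cong_int_iff)
  then show ?thesis by (simp add: cong_iff_dvd_diff)
qed

text \<open>
  Solutions sorted by a divisor \<open>d\<close> of \<open>p - 1\<close> that is a multiple of the order of \<open>x\<close>. The sets for
  different \<open>d\<close> may overlap, which is harmless for an upper bound.
\<close>

definition solutions_of_order :: "int poly \<Rightarrow> nat \<Rightarrow> nat \<Rightarrow> int set" where
  "solutions_of_order f p d = {x. 1 \<le> x \<and> x \<le> int p - 1 \<and> int p dvd x ^ d - 1 \<and> int d dvd poly f x}"

lemma card_solutions_of_order_le: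
  fixes y :: real
  assumes p: "prime p" and y: "y ^ 13 = real p" "4 \<le> y" and d: "d dvd p - 1"
  shows "real (card (solutions_of_order f p d)) \<le> real (card (roots_mod f d)) * (3 * y ^ 6)"
proof -
  let ?X = "solutions_of_order f p d"
  have "p > 1" using p by (rule prime_gt_1_nat)
  then have "d > 0" using dvd_pos_nat[OF _ d] by simp
  have "?X \<subseteq> {1..int p - 1}" by (auto simp: solutions_of_order_def)
  then have fin: "finite ?X" by (rule finite_subset) simp
  have "?X \<subseteq> (\<Union>a\<in>roots_mod f d. {x \<in> ?X. x mod int d = a})"
    using \<open>d > 0\<close> by (auto simp: solutions_of_order_def roots_mod_def dvd_poly_mod_iff)
  then have "card ?X \<le> card (\<Union>a\<in>roots_mod f d. {x \<in> ?X. x mod int d = a})"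
    using fin by (intro card_mono) (auto simp: finite_roots_mod)
  also have "\<dots> \<le> (\<Sum>a\<in>roots_mod f d. card {x \<in> ?X. x mod int d = a})"
    by (rule card_UN_le) (rule finite_roots_mod)
  finally have "real (card ?X) \<le> (\<Sum>a\<in>roots_mod f d. real (card {x \<in> ?X. x mod int d = a}))"
    by (simp flip: of_nat_sum)
  also have "\<dots> \<le> (\<Sum>a\<in>roots_mod f d. 3 * y ^ 6)"
    by (intro sum_mono card_class_le[OF p y d]) (auto simp: solutions_of_order_def)
  finally show ?thesis by simp
qed

lemma T_le_sum_solutions_of_order:
  assumes p: "prime p"
  shows "T f p \<le> (\<Sum>d | d dvd p - 1. card (solutions_of_order f p d))"
proof -
  have "p > 1" using p by (rule prime_gt_1_nat)
  then have fin: "finite {d. d dvd p - 1}" by simp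
  have "{x. 1 \<le> x \<and> x \<le> int p - 1 \<and> [mod_powi p x (poly f x) = 1] (mod int p)}
      \<subseteq> (\<Union>d\<in>{d. d dvd p - 1}. solutions_of_order f p d)"
  proof safe
    fix x assume x: "1 \<le> x" "x \<le> int p - 1" "[mod_powi p x (poly f x) = 1] (mod int p)"
    define d where "d = gcd (nat \<bar>poly f x\<bar>) (p - 1)"
    have d: "d dvd p - 1" "d dvd nat \<bar>poly f x\<bar>"
      by (simp_all only: d_def gcd_dvd1 gcd_dvd2)
    from d(2) have "int d dvd poly f x"
      by (simp add: nat_abs_dvd_iff dvd_nat_abs_iff)
    moreover have "int p dvd x ^ d - 1"
      unfolding d_def by (rule power_eq_1_mod_gcd[OF p x])
    ultimately show "x \<in> (\<Union>d\<in>{d. d dvd p - 1}. solutions_of_order f p d)"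
      using d(1) x by (auto simp: solutions_of_order_def)
  qed
  moreover have "finite (\<Union>d\<in>{d. d dvd p - 1}. solutions_of_order f p d)"
  proof (rule finite_subset)
    show "(\<Union>d\<in>{d. d dvd p - 1}. solutions_of_order f p d) \<subseteq> {1..int p - 1}"
      by (auto simp: solutions_of_order_def)
  qed simp
  ultimately have "T f p \<le> card (\<Union>d\<in>{d. d dvd p - 1}. solutions_of_order f p d)"
    unfolding T_def by (intro card_mono)
  also have "\<dots> \<le> (\<Sum>d | d dvd p - 1. card (solutions_of_order f p d))"
    by (rule card_UN_le) (rule fin)
  finally show ?thesis .
qed

lemma card_roots_mod_growth:
  assumes "squarefree_poly f" and "\<epsilon> > 0"
  shows "\<exists>C>0. \<forall>n>0. real (card (roots_mod f n)) \<le> C * real n powr \<epsilon>"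
proof -
  obtain K where K: "\<And>q k. prime q \<Longrightarrow> card (roots_mod f (q ^ k)) \<le> K"
    using card_roots_mod_prime_power_bounded[OF assms(1)] by blast
  show ?thesis
  proof (rule submultiplicative_growth[where K = "real K"])
    have "card (roots_mod f 1) \<le> card {0 :: int}"
      by (intro card_mono) (auto simp: roots_mod_def)
    then show "real (card (roots_mod f 1)) \<le> 1" by simp
    show "real (card (roots_mod f (m * n))) \<le> real (card (roots_mod f m)) * real (card (roots_mod f n))"
      if "coprime m n" for m n
      using card_roots_mod_mult_le[OF that, of f] by (simp flip: of_nat_mult)
    show "real (card (roots_mod f (q ^ k))) \<le> real K * (real k + 1)" if "prime q" for q k
    proof -
      have "real (card (roots_mod f (q ^ k))) \<le> real K * 1" using K[OF that] by simp
      also have "\<dots> \<le> real K * (real k + 1)" by (intro mult_left_mono) auto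
      finally show ?thesis .
    qed
  qed (use assms in auto)
qed

lemma T_le_constant_times_power:
  assumes f: "squarefree_poly f" and "\<epsilon> > 0"
  shows "\<exists>C>0. \<forall>p. prime p \<longrightarrow> p \<ge> 4 ^ 13 \<longrightarrow> real (T f p) \<le> C * real p powr (6 / 13 + 2 * \<epsilon>)"
proof -
  obtain C where C: "C > 0" "\<And>n. n > 0 \<Longrightarrow> real (card (roots_mod f n)) \<le> C * real n powr \<epsilon>"
    using card_roots_mod_growth[OF assms] by blast
  obtain C' where C': "C' > 0" "\<And>n. n > 0 \<Longrightarrow> real (card {d. d dvd n}) \<le> C' * real n powr \<epsilon>"
    using card_divisors_growth[OF \<open>\<epsilon> > 0\<close>] by blast
  have "real (T f p) \<le> 3 * C * C' * real p powr (6 / 13 + 2 * \<epsilon>)"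
    if p: "prime p" "p \<ge> 4 ^ 13" for p
  proof -
    define y where "y = real p powr (1 / 13)"
    have "p > 1" using p(1) by (rule prime_gt_1_nat)
    then have y13: "y ^ 13 = real p" and y6: "y ^ 6 = real p powr (6 / 13)"
      by (auto simp: y_def powr_power)
    have "real (4 ^ 13) \<le> real p" using p(2) by (simp only: of_nat_le_iff)
    then have "4 ^ 13 \<le> y ^ 13" by (simp add: y13)
    then have y4: "4 \<le> y"
      by (rule power_mono_iff[THEN iffD1, rotated -1]) (simp_all add: y_def)
    have "real (T f p) \<le> real (\<Sum>d | d dvd p - 1. card (solutions_of_order f p d))"
      using T_le_sum_solutions_of_order[OF p(1)] by (simp only: of_nat_le_iff)
    also have "\<dots> = (\<Sum>d | d dvd p - 1. real (card (solutions_of_order f p d)))"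
      by simp
    also have "\<dots> \<le> (\<Sum>d | d dvd p - 1. C * real p powr \<epsilon> * (3 * y ^ 6))"
    proof (rule sum_mono)
      fix d assume "d \<in> {d. d dvd p - 1}"
      then have d: "d dvd p - 1" by simp
      then have "d > 0" using dvd_pos_nat[OF _ d] \<open>p > 1\<close> by simp
      have "d \<le> p - 1" using \<open>p > 1\<close> d by (intro dvd_imp_le) auto
      have "real (card (solutions_of_order f p d)) \<le> real (card (roots_mod f d)) * (3 * y ^ 6)"
        by (rule card_solutions_of_order_le[OF p(1) y13 y4 d])
      also have "real (card (roots_mod f d)) \<le> C * real d powr \<epsilon>"
        using C(2)[OF \<open>d > 0\<close>] .
      also have "C * real d powr \<epsilon> \<le> C * real p powr \<epsilon>"
        using C(1) \<open>d \<le> p - 1\<close> \<open>\<epsilon> > 0\<close> by (intro mult_left_mono powr_mono2) auto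
      finally show "real (card (solutions_of_order f p d)) \<le> C * real p powr \<epsilon> * (3 * y ^ 6)"
        using y4 by (simp add: mult_right_mono)
    qed
    also have "\<dots> = real (card {d. d dvd p - 1}) * (C * real p powr \<epsilon> * (3 * y ^ 6))"
      by simp
    also have "\<dots> \<le> (C' * real p powr \<epsilon>) * (C * real p powr \<epsilon> * (3 * y ^ 6))"
    proof (rule mult_right_mono)
      have "real (card {d. d dvd p - 1}) \<le> C' * real (p - 1) powr \<epsilon>"
        using C'(2)[of "p - 1"] \<open>p > 1\<close> by simp
      also have "\<dots> \<le> C' * real p powr \<epsilon>"
        using C'(1) \<open>\<epsilon> > 0\<close> by (intro mult_left_mono powr_mono2) auto
      finally show "real (card {d. d dvd p - 1}) \<le> C' * real p powr \<epsilon>" .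
    qed (use C(1) y4 in auto)
    also have "\<dots> = 3 * C * C' * (real p powr (6 / 13) * (real p powr \<epsilon> * real p powr \<epsilon>))"
      by (simp add: y6)
    also have "real p powr (6 / 13) * (real p powr \<epsilon> * real p powr \<epsilon>) = real p powr (6 / 13 + 2 * \<epsilon>)"
      by (simp flip: powr_add)
    finally show ?thesis .
  qed
  moreover have "3 * C * C' > 0" using C(1) C'(1) by simp
  ultimately show ?thesis by blast
qed

lemma eventually_T_le_power:
  assumes f: "squarefree_poly f" and "\<epsilon> > 0"
  shows "\<forall>\<^sub>F p in primes_at_top. real (T f p) \<le> real p powr (6 / 13 + \<epsilon>)"
proof -
  obtain C where C: "C > 0"
    "\<And>p. prime p \<Longrightarrow> p \<ge> 4 ^ 13 \<Longrightarrow> real (T f p) \<le> C * real p powr (6 / 13 + 2 * (\<epsilon> / 3))"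
    using T_le_constant_times_power[OF f, of "\<epsilon> / 3"] \<open>\<epsilon> > 0\<close> by auto
  define N where "N = max (4 ^ 13) (nat \<lceil>C powr (3 / \<epsilon>)\<rceil>)"
  have "real (T f p) \<le> real p powr (6 / 13 + \<epsilon>)" if p: "p \<ge> N" "prime p" for p
  proof -
    have "C powr (3 / \<epsilon>) \<le> real p" using p(1) unfolding N_def by linarith
    then have "(C powr (3 / \<epsilon>)) powr (\<epsilon> / 3) \<le> real p powr (\<epsilon> / 3)"
      using \<open>\<epsilon> > 0\<close> by (intro powr_mono2) auto
    then have "C \<le> real p powr (\<epsilon> / 3)"
      using C(1) \<open>\<epsilon> > 0\<close> by (simp add: powr_powr)
    then have "C * real p powr (6 / 13 + 2 * (\<epsilon> / 3))
        \<le> real p powr (\<epsilon> / 3) * real p powr (6 / 13 + 2 * (\<epsilon> / 3))"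
      by (rule mult_right_mono) simp
    also have "\<dots> = real p powr (\<epsilon> / 3 + (6 / 13 + 2 * (\<epsilon> / 3)))"
      by (rule powr_add[symmetric])
    also have "\<epsilon> / 3 + (6 / 13 + 2 * (\<epsilon> / 3)) = 6 / 13 + \<epsilon>"
      by linarith
    finally show ?thesis
      using C(2)[of p] p by (simp add: N_def)
  qed
  then show ?thesis
    unfolding eventually_primes_at_top by blast
qed

theorem theorem10:
  fixes f :: "int poly"
  assumes "squarefree_poly f"
  shows "\<exists>\<epsilon> :: nat \<Rightarrow> real. \<epsilon> \<in> o[primes_at_top](\<lambda>_. 1) \<and>
           (\<forall>\<^sub>F p in primes_at_top. real (T f p) \<le> real p powr (6 / 13 + \<epsilon> p))"
proof -
  \<comment> \<open>The exponent that makes the bound an equality, cut off from below at \<open>0\<close>.\<close>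
  define \<epsilon> where "\<epsilon> p = max 0 (log (real p) (real (T f p)) - 6 / 13)" for p
  have gt_1: "\<forall>\<^sub>F p in primes_at_top. p > 1"
    unfolding eventually_primes_at_top by (intro exI[of _ 0] allI impI prime_gt_1_nat)
  have "(\<epsilon> \<longlongrightarrow> 0) primes_at_top"
  proof (rule tendstoI)
    fix e :: real assume "e > 0"
    then have "\<forall>\<^sub>F p in primes_at_top. real (T f p) \<le> real p powr (6 / 13 + e / 2)"
      by (intro eventually_T_le_power assms) simp
    with gt_1 show "\<forall>\<^sub>F p in primes_at_top. dist (\<epsilon> p) 0 < e"
    proof eventually_elim
      case (elim p)
      have "log (real p) (real (T f p)) \<le> 6 / 13 + e / 2"
      proof (cases "T f p = 0")
        \<comment> \<open>Here the logarithm has its default value \<open>0\<close>.\<close>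
        case True
        then show ?thesis using \<open>e > 0\<close> by (simp add: log_def)
      next
        case False
        then show ?thesis using elim by (simp add: log_le_iff)
      qed
      then show ?case using \<open>e > 0\<close> by (auto simp: \<epsilon>_def dist_real_def)
    qed
  qed
  then have "\<epsilon> \<in> o[primes_at_top](\<lambda>_. 1)"
    by (intro smalloI_tendsto) auto
  moreover have "\<forall>\<^sub>F p in primes_at_top. real (T f p) \<le> real p powr (6 / 13 + \<epsilon> p)"
    using gt_1
  proof eventually_elim
    case (elim p)
    show ?case
    proof (cases "T f p = 0")
      case False
      then have "real (T f p) = real p powr log (real p) (real (T f p))"
        using elim by (simp add: powr_log_cancel)
      also have "\<dots> \<le> real p powr (6 / 13 + \<epsilon> p)"
        using elim by (intro powr_mono) (auto simp: \<epsilon>_def)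
      finally show ?thesis .
    qed simp
  qed
  ultimately show ?thesis by blast
qed

end
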